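(* Let $n_0,n_1$ be nonnegative integers and let $n=n_0+n_1$ with $1\le n\le 5$. Then for all nonnegative integers $a,b,k$, $$\operatorname{CT}_x\prod_{n_0+1\le i\ne j\le n}\left(1-\frac{x_i}{x_j}\right)\cdot\prod_{l=1}^n\left(1-\frac{x_l}{x_0}\right)^{a}\left(1-\frac{x_0}{x_l}\right)^{b}\prod_{1\le i\ne j\le n}\left(1-\frac{x_i}{x_j}\right)^{k}$$ $$=M_{n_0}(a,b,k)\prod_{j=0}^{n_1-1}\frac{(j+1)\,((k+1)j+a+b+kn_0)!\,(kj+k+j+kn_0)!}{k!\,((k+1)j+a+kn_0)!\,((k+1)j+b+kn_0)!}.$$
   Context: $\operatorname{CT}_x$ denotes the constant term (the coefficient of $x_0^0x_1^0\cdots x_n^0$) of a Laurent polynomial in $x_0,\ldots,x_n$. Products over $i\neq j$ are over ordered pairs. For $n_0\ge 0$, $$M_{n_0}(a,b,k):=\prod_{l=0}^{n_0-1}\frac{(a+b+kl)!\,(k(l+1))!}{(a+kl)!\,(b+kl)!\,k!},$$ with empty products equal to $1$. *)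

theory Defs
  imports Complex_Main "HOL-Library.Poly_Mapping"
begin

text \<open>
  Laurent polynomials in the variables \<open>x\<^sub>0, x\<^sub>1, x\<^sub>2, \<dots>\<close> with rational coefficients: the
  convolution ring of finitely supported maps from exponent vectors to coefficients, where
  exponent vectors are finitely supported integer sequences. A Laurent polynomial in
  \<open>x\<^sub>0, \<dots>, x\<^sub>n\<close> is an element in which no other variable occurs, so its coefficient at the
  zero exponent vector is its coefficient of \<open>x\<^sub>0\<^sup>0 x\<^sub>1\<^sup>0 \<cdots> x\<^sub>n\<^sup>0\<close>.
\<close>

type_synonym laurent = "(nat \<Rightarrow>\<^sub>0 int) \<Rightarrow>\<^sub>0 rat"

definition lvar :: "nat \<Rightarrow> laurent" where
  "lvar i = Poly_Mapping.single (Poly_Mapping.single i 1) 1"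

text \<open>The Laurent monomial \<open>x\<^sub>i / x\<^sub>j\<close>; the ring has no division operator.\<close>

definition lratio :: "nat \<Rightarrow> nat \<Rightarrow> laurent" where
  "lratio i j = Poly_Mapping.single (Poly_Mapping.single i 1 - Poly_Mapping.single j 1) 1"

lemma lratio_mult_lvar: "lratio i j * lvar j = lvar i"
  by (simp add: lratio_def lvar_def mult_single)

definition CT :: "laurent \<Rightarrow> rat" where
  "CT p = Poly_Mapping.lookup p 0"

definition M :: "nat \<Rightarrow> nat \<Rightarrow> nat \<Rightarrow> nat \<Rightarrow> rat" where
  "M n0 a b k =
     (\<Prod>l<n0. (fact (a + b + k * l) * fact (k * (l + 1))) /
              (fact (a + k * l) * fact (b + k * l) * fact k))"

definition off_diag :: "nat \<Rightarrow> nat \<Rightarrow> (nat \<times> nat) set" where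
  "off_diag p q = {(i, j). i \<in> {p..q} \<and> j \<in> {p..q} \<and> i \<noteq> j}"

end

theory Submission
  imports Defs "HOL-Library.FuncSet" "HOL-Library.Infinite_Set"
    "HOL-Computational_Algebra.Polynomial"
begin

text \<open>
  The Laurent polynomial is \<open>\<Prod>(1 - x\<^sub>i / x\<^sub>j)^m i j\<close> over ordered pairs of distinct indices in
  \<open>{0..n}\<close>, where \<open>m l 0 = a\<close>, \<open>m 0 l = b\<close> and \<open>m i j\<close> is \<open>k + 1\<close> if both indices exceed \<open>n0\<close> and
  \<open>k\<close> otherwise. Call an index \<open>l \<ge> 1\<close> heavy if \<open>l > n0\<close> and light if \<open>l \<le> n0\<close>. Multiplying by
  \<open>\<Prod>x\<^sub>j^d j\<close> with \<open>d j = (\<Sum>i. m i j)\<close> turns the constant term into the coefficient of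
  \<open>\<Prod>x\<^sub>j^d j\<close> in the homogeneous polynomial \<open>\<Prod>(x\<^sub>j - x\<^sub>i)^m i j\<close>, whose degree is exactly
  \<open>\<Sum>j. d j\<close>.

  The idea, in the spirit of the Combinatorial Nullstellensatz and of Karasev and Petrov, is that
  a coefficient of top degree does not notice terms of lower degree. So every power
  \<open>(x\<^sub>j - x\<^sub>i)^m i j\<close> may be replaced by a product of factors \<open>x\<^sub>j - x\<^sub>i - t\<close> over \<open>m i j\<close>
  consecutive integers \<open>t\<close>, and the coefficient may be read off by any linear functional that, in
  each variable separately, kills the powers below \<open>d j\<close> and maps the power \<open>d j\<close> to \<open>1\<close>
  (\<open>CT_eq_grid_functional\<close>). For \<open>x\<^sub>l\<close> with \<open>l \<ge> 1\<close> this is the divided difference at \<open>d l + 1\<close>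
  integer nodes. For \<open>x\<^sub>0\<close> it is \<open>p \<mapsto> (p div W)(0)\<close> with \<open>W\<close> monic of degree \<open>n * a\<close>, in effect a
  divided difference with repeated nodes: the node \<open>0\<close> and the roots of \<open>W\<close>.

  The shifts, the nodes and \<open>W\<close> are chosen so that a single grid point contributes. The factors of
  the pairs \<open>i, j \<ge> 1\<close> vanish unless the integers \<open>c\<^sub>1, \<dots>, c\<^sub>n\<close> are separated: the larger exceeds
  the smaller by at least \<open>m i j\<close>, and by one more if the larger belongs to the smaller index.
  Let \<open>s i = i * k + (i - n0)\<close> (truncated subtraction). This is the staircase obtained by placing
  the light indices first, with gaps \<open>k\<close>, and then the heavy ones, with gaps \<open>k + 1\<close>. All nodes lie
  in \<open>{0..s (n - 1) + b}\<close>, and this interval has the right size \<open>d l + 1\<close> for heavy \<open>l\<close>. For light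
  \<open>l\<close> it is too large by the number of \<open>i\<close> with \<open>n0 \<le> i < n - 1\<close>, and the points \<open>s i + b + 1\<close> for
  these \<open>i\<close> are removed. With this choice the \<open>i\<close>-th smallest coordinate (counting from \<open>0\<close>) of a
  separated grid point always lies in the window \<open>{s i..s i + b}\<close>
  (\<open>separated_grid_windows\<close>). A heavy coordinate is at least \<open>k + 1\<close> below its successor, and a light
  one at least \<open>k\<close>. Going up from the bottom, this gives the lower ends of the windows. Going down
  from the top, it gives the upper ends, since a light coordinate could pass them only by hitting a
  removed point.

  A coordinate \<open>c\<close> contributes to the polynomial in \<open>x\<^sub>0\<close> the roots \<open>{c - b + 1..c + a}\<close>. If \<open>c\<close> is in
  the \<open>i\<close>-th window, these include \<open>{s i + 1..s i + a}\<close>. Hence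
  \<open>W = \<Prod>i. (x\<^sub>0 - s i - 1) \<cdots> (x\<^sub>0 - s i - a)\<close> divides it, and the functional in \<open>x\<^sub>0\<close> reduces to the
  evaluation at \<open>x\<^sub>0 = 0\<close> divided by \<open>W(0)\<close>. At \<open>x\<^sub>0 = 0\<close> a coordinate smaller than \<open>b\<close> produces a zero.
  If all coordinates are at least \<open>b\<close>, the \<open>i\<close>-th smallest one is \<open>s i + b\<close>, the upper end of its
  window, and tightness of the gaps forces the indices to occur in increasing order
  (\<open>CT_eq_tight_node_value\<close>). What is left is one product of differences, which is
  evaluated index by index (\<open>label_factor_eq\<close>) and rearranged (\<open>prod_label_factors\<close>).
\<close>

section \<open>Constant terms as coefficients of a polynomial\<close>

definition monomial_exponent :: "nat \<Rightarrow> (nat \<Rightarrow> nat) \<Rightarrow> (nat \<Rightarrow>\<^sub>0 int)" where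
  "monomial_exponent n d = (\<Sum>i\<in>{0..n}. Poly_Mapping.single i (int (d i)))"

lemma lookup_monomial_exponent:
  "Poly_Mapping.lookup (monomial_exponent n d) i = (if i \<le> n then int (d i) else 0)"
proof -
  have "Poly_Mapping.lookup (monomial_exponent n d) i
      = (\<Sum>j\<in>{0..n}. if j = i then int (d j) else 0)"
    by (simp add: monomial_exponent_def lookup_sum lookup_single when_def)
  then show ?thesis by simp
qed

lemma monomial_exponent_eq_iff:
  "monomial_exponent n d = monomial_exponent n e \<longleftrightarrow> (\<forall>i\<le>n. d i = e i)"
proof
  assume "monomial_exponent n d = monomial_exponent n e"
  then have "Poly_Mapping.lookup (monomial_exponent n d) i
      = Poly_Mapping.lookup (monomial_exponent n e) i" for i by simp
  then show "\<forall>i\<le>n. d i = e i"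
    by (metis lookup_monomial_exponent of_nat_eq_iff)
next
  assume "\<forall>i\<le>n. d i = e i"
  then show "monomial_exponent n d = monomial_exponent n e"
    by (simp add: monomial_exponent_def)
qed

lemma lvar_power: "lvar i ^ m = Poly_Mapping.single (Poly_Mapping.single i (int m)) 1"
  by (induction m) (simp_all add: lvar_def mult_single single_add [symmetric] add.commute)

lemma prod_lvar_powers:
  "(\<Prod>i\<in>{0..n}. lvar i ^ d i) = Poly_Mapping.single (monomial_exponent n d) 1"
proof -
  have "(\<Prod>i\<in>S. lvar i ^ d i)
      = Poly_Mapping.single (\<Sum>i\<in>S. Poly_Mapping.single i (int (d i))) 1"
    if "finite S" for S
    using that by (induction S) (simp_all add: lvar_power mult_single)
  then show ?thesis by (simp add: monomial_exponent_def)
qed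

lemma lookup_single_times:
  fixes p :: laurent
  shows "Poly_Mapping.lookup (Poly_Mapping.single e 1 * p) e = CT p"
proof -
  have *: "Poly_Mapping.lookup p k * (1 when e = e + k) = (Poly_Mapping.lookup p k when k = 0)" for k
    by (auto simp: when_def)
  have "Poly_Mapping.lookup (Poly_Mapping.single e 1 * p) e
      = Sum_any (\<lambda>l. (1 when e = l) * Sum_any (\<lambda>q. Poly_Mapping.lookup p q when e = l + q))"
    by (simp add: lookup_mult lookup_single)
  also have "\<dots> = Sum_any (\<lambda>q. Poly_Mapping.lookup p q when e = e + q)"
    by (simp add: when_mult)
  also have "\<dots> = CT p"
    by (simp add: CT_def)
  finally show ?thesis .
qed

lemma finite_off_diag [simp]: "finite (off_diag p q)"
  by (rule finite_subset[of _ "{p..q} \<times> {p..q}"]) (auto simp: off_diag_def)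

lemma prod_off_diag_snd:
  fixes f :: "nat \<Rightarrow> 'a::comm_monoid_mult"
  shows "(\<Prod>(i, j)\<in>off_diag p q. f j ^ m i j) = (\<Prod>j\<in>{p..q}. f j ^ (\<Sum>i\<in>{p..q}-{j}. m i j))"
proof -
  have eq: "off_diag p q = prod.swap ` (SIGMA j:{p..q}. {p..q} - {j})"
    by (auto simp: off_diag_def image_iff)
  have "(\<Prod>(i, j)\<in>off_diag p q. f j ^ m i j)
      = (\<Prod>(j, i)\<in>(SIGMA j:{p..q}. {p..q} - {j}). f j ^ m i j)"
    unfolding eq by (subst prod.reindex) (auto simp: case_prod_beta)
  also have "\<dots> = (\<Prod>j\<in>{p..q}. \<Prod>i\<in>{p..q}-{j}. f j ^ m i j)"
    by (subst prod.Sigma) auto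
  finally show ?thesis by (simp add: power_sum)
qed

text \<open>
  Multiplication by the monomial \<open>\<Prod>x\<^sub>j^d j\<close> clears the denominators, since each factor
  \<open>1 - x\<^sub>i / x\<^sub>j\<close> absorbs one \<open>x\<^sub>j\<close>, and it moves the zero exponent vector to \<open>d\<close>.
\<close>

lemma CT_eq_coefficient:
  "CT (\<Prod>(i, j)\<in>off_diag 0 n. (1 - lratio i j) ^ m i j)
     = Poly_Mapping.lookup (\<Prod>(i, j)\<in>off_diag 0 n. (lvar j - lvar i) ^ m i j)
         (monomial_exponent n (\<lambda>j. \<Sum>i\<in>{0..n}-{j}. m i j))"
proof -
  have factor: "lvar j * (1 - lratio i j) = lvar j - lvar i" for i j
    using lratio_mult_lvar[of i j] by (simp add: right_diff_distrib mult.commute)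
  have "(\<Prod>(i, j)\<in>off_diag 0 n. (lvar j - lvar i) ^ m i j)
      = (\<Prod>(i, j)\<in>off_diag 0 n. lvar j ^ m i j * (1 - lratio i j) ^ m i j)"
    by (rule prod.cong) (auto simp: power_mult_distrib [symmetric] factor)
  also have "\<dots> = (\<Prod>(i, j)\<in>off_diag 0 n. lvar j ^ m i j)
      * (\<Prod>(i, j)\<in>off_diag 0 n. (1 - lratio i j) ^ m i j)"
    by (simp add: prod.distrib case_prod_beta)
  finally show ?thesis
    by (simp add: prod_off_diag_snd prod_lvar_powers lookup_single_times)
qed

section \<open>Extracting a top coefficient from values on a grid\<close>

text \<open>
  The coefficient of \<open>f c\<close> in the divided difference of \<open>f\<close> at the nodes \<open>C\<close>.
\<close>

definition node_weight :: "int set \<Rightarrow> int \<Rightarrow> rat" where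
  "node_weight C c = 1 / (\<Prod>c'\<in>C - {c}. of_int (c - c'))"

text \<open>
  The Lagrange interpolation polynomial of \<open>x^m\<close> at \<open>d + 1 > m\<close> nodes is \<open>x^m\<close> itself. The left-hand side
  is its coefficient of \<open>x^d\<close>.
\<close>

lemma sum_node_weight_power:
  assumes "finite C" and "card C = Suc d" and "m \<le> d"
  shows "(\<Sum>c\<in>C. node_weight C c * of_int c ^ m) = (if m = d then 1 else 0)"
proof -
  define lag :: "int \<Rightarrow> rat poly" where
    "lag c = smult (node_weight C c) (\<Prod>c'\<in>C - {c}. [:- of_int c', 1:])" for c
  define p :: "rat poly" where "p = (\<Sum>c\<in>C. smult (of_int c ^ m) (lag c))"
  have lag_deg: "degree (\<Prod>c'\<in>C - {c}. [:- of_int c', 1 :: rat:]) = d" if "c \<in> C" for c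
    using that assms(1,2) by (simp add: degree_prod_sum_eq)
  have lag_lead: "lead_coeff (\<Prod>c'\<in>C - {c}. [:- of_int c', 1 :: rat:]) = 1" for c
    unfolding lead_coeff_prod by simp
  have lag_eval: "poly (lag c) (of_int e) = (if c = e then 1 else 0)"
    if "c \<in> C" "e \<in> C" for c e
  proof (cases "c = e")
    case True
    have "(\<Prod>c'\<in>C - {c}. of_int (c - c') :: rat) \<noteq> 0"
      using assms(1) by (auto simp: prod_zero_iff)
    with True show ?thesis
      by (simp add: lag_def node_weight_def poly_prod)
  next
    case False
    have "(\<Prod>c'\<in>C - {c}. (of_int e - of_int c') :: rat) = 0"
      using assms(1) that False by (auto simp: prod_zero_iff)
    with False show ?thesis
      by (simp add: lag_def poly_prod)
  qed
  have "p = monom 1 m"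
  proof (rule poly_eqI_degree)
    fix x :: rat assume "x \<in> of_int ` C"
    then obtain e where e: "e \<in> C" "x = of_int e" by auto
    have "poly p x = (\<Sum>c\<in>C. of_int c ^ m * (if c = e then 1 else 0))"
      unfolding p_def poly_sum poly_smult e(2)
      by (rule sum.cong) (use e(1) lag_eval in auto)
    also have "\<dots> = of_int e ^ m" using e(1) assms(1) by (simp add: if_distrib cong: if_cong)
    finally show "poly p x = poly (monom 1 m) x" by (simp add: e(2) poly_monom)
  next
    have "degree p \<le> d"
      unfolding p_def
    proof (rule degree_sum_le[OF assms(1)])
      fix c assume "c \<in> C"
      show "degree (smult (of_int c ^ m) (lag c)) \<le> d"
        unfolding lag_def using lag_deg[OF \<open>c \<in> C\<close>]
        by (intro order_trans[OF degree_smult_le]) simp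
    qed
    moreover have "card (of_int ` C :: rat set) = Suc d"
      by (simp add: card_image inj_on_def assms(2))
    ultimately show "degree p < card (of_int ` C :: rat set)" by simp
  next
    have "card (of_int ` C :: rat set) = Suc d"
      by (simp add: card_image inj_on_def assms(2))
    then show "degree (monom 1 m :: rat poly) < card (of_int ` C :: rat set)"
      using assms(3) by (simp add: degree_monom_eq)
  qed
  then have "coeff p d = (if m = d then 1 else 0)" by simp
  moreover have "coeff p d = (\<Sum>c\<in>C. of_int c ^ m * node_weight C c)"
    unfolding p_def coeff_sum
    by (rule sum.cong) (use lag_deg lag_lead in \<open>auto simp: lag_def\<close>)
  ultimately show ?thesis by (simp add: mult.commute)
qed

text \<open>
  The variable \<open>x\<^sub>0\<close> stays a polynomial variable while the others are specialised to integers, because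
  the functional applied to \<open>x\<^sub>0\<close> involves multiple nodes and so is not determined by values.
\<close>

definition grid_point :: "(nat \<Rightarrow> int) \<Rightarrow> nat \<Rightarrow> rat poly" where
  "grid_point c i = (if i = 0 then [:0, 1:] else [:of_int (c i):])"

text \<open>
  The map \<open>p \<mapsto> (p div W)(0)\<close> is the divided difference at \<open>0\<close> and the roots of \<open>W\<close>, counted
  with multiplicity: it kills the degrees below that of \<open>W\<close>, and on a multiple of \<open>W\<close> it is the
  evaluation at \<open>0\<close> divided by \<open>W(0)\<close> if \<open>W(0)\<close> is nonzero.
\<close>

definition grid_functional ::
    "rat poly \<Rightarrow> nat \<Rightarrow> (nat \<Rightarrow> int set) \<Rightarrow> ((nat \<Rightarrow> rat poly) \<Rightarrow> rat poly) \<Rightarrow> rat" where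
  "grid_functional W n C F =
     (\<Sum>c\<in>PiE {1..n} C. (\<Prod>l=1..n. node_weight (C l) (c l)) * poly (F (grid_point c) div W) 0)"

lemma grid_functional_difference:
  "grid_functional W n C (\<lambda>x. (x j - x i - [:t:]) * F x)
     = grid_functional W n C (\<lambda>x. x j * F x) - grid_functional W n C (\<lambda>x. x i * F x)
       - t * grid_functional W n C F"
proof -
  have split: "poly ((p - q - [:t:]) * f div W) 0
      = poly (p * f div W) 0 - poly (q * f div W) 0 - t * poly (f div W) 0" for p q f
    by (simp add: left_diff_distrib poly_div_diff_left div_smult_left)
  show ?thesis
    unfolding grid_functional_def split
    by (simp add: right_diff_distrib sum_subtractf sum_distrib_left mult.left_commute)
qed

lemma lookup_prod_lvar:
  "Poly_Mapping.lookup (\<Prod>i\<in>{0..n}. lvar i ^ e i) (monomial_exponent n d)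
     = (if \<forall>i\<le>n. e i = d i then 1 else 0)"
  by (simp add: prod_lvar_powers lookup_single when_def monomial_exponent_eq_iff)

text \<open>
  On a monomial the functional splits into one factor per variable. If the exponent vector differs
  from \<open>d\<close> and has no larger total degree, some exponent is below its \<open>d i\<close>, and that factor is zero.
\<close>

lemma grid_functional_monomial:
  assumes C: "\<And>l. l \<in> {1..n} \<Longrightarrow> finite (C l) \<and> card (C l) = Suc (d l)"
    and W: "lead_coeff W = 1" "degree W = d 0"
    and e: "(\<Sum>i=0..n. e i) \<le> (\<Sum>i=0..n. d i)"
  shows "grid_functional W n C (\<lambda>x. \<Prod>i\<in>{0..n}. x i ^ e i) = (if \<forall>i\<le>n. e i = d i then 1 else 0)"
proof -
  let ?q = "poly (monom 1 (e 0) div W) 0"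
  let ?s = "\<lambda>l. \<Sum>c\<in>C l. node_weight (C l) c * of_int c ^ e l"
  have point: "(\<Prod>i\<in>{0..n}. grid_point c i ^ e i)
      = smult (\<Prod>l=1..n. of_int (c l) ^ e l) (monom 1 (e 0))" for c
  proof -
    have "(\<Prod>i\<in>{0..n}. grid_point c i ^ e i) = [:0, 1:] ^ e 0 * (\<Prod>l=1..n. grid_point c l ^ e l)"
      by (simp add: prod.atLeast_Suc_atMost grid_point_def)
    also have "(\<Prod>l=1..n. grid_point c l ^ e l) = (\<Prod>l=1..n. [:of_int (c l) ^ e l:])"
      by (rule prod.cong) (auto simp: grid_point_def poly_const_pow)
    also have "\<dots> = [:\<Prod>l=1..n. of_int (c l) ^ e l:]"
      by (induction n) (simp_all add: mult.commute)
    finally show ?thesis by (simp add: monom_altdef mult.commute)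
  qed
  have "grid_functional W n C (\<lambda>x. \<Prod>i\<in>{0..n}. x i ^ e i)
      = (\<Sum>c\<in>PiE {1..n} C. \<Prod>l=1..n. node_weight (C l) (c l) * of_int (c l) ^ e l) * ?q"
    by (simp add: grid_functional_def point div_smult_left sum_distrib_right prod.distrib mult.assoc)
  also have "\<dots> = (\<Prod>l=1..n. ?s l) * ?q"
    using C by (subst prod_sum_PiE) auto
  finally have val: "grid_functional W n C (\<lambda>x. \<Prod>i\<in>{0..n}. x i ^ e i) = (\<Prod>l=1..n. ?s l) * ?q" .
  have W0: "W \<noteq> 0" using W(1) by auto
  show ?thesis
  proof (cases "\<forall>i\<le>n. e i = d i")
    case True
    have "?s l = 1" if "l \<in> {1..n}" for l
      using sum_node_weight_power[of "C l" "d l" "e l"] C[OF that] True that by simp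
    moreover have "monom 1 (e 0) div W = 1"
    proof -
      have "degree (monom 1 (e 0) - W) < degree W \<or> monom 1 (e 0) - W = 0"
        using eq_zero_or_degree_less[of "monom 1 (e 0) - W" "degree W"] True W
        by (auto simp: degree_diff_le degree_monom_eq)
      then have "(monom 1 (e 0) - W) div W = 0" by (auto simp: div_poly_less)
      then show ?thesis using W0 by (simp add: poly_div_diff_left)
    qed
    ultimately show ?thesis using val True by simp
  next
    case False
    have "\<exists>i\<le>n. e i < d i"
    proof (rule ccontr)
      assume "\<not> ?thesis"
      then have ge: "\<forall>i\<in>{0..n}. d i \<le> e i" by (auto simp: not_less)
      moreover from False obtain i where "i \<le> n" "e i \<noteq> d i" by auto
      ultimately have "(\<Sum>i=0..n. d i) < (\<Sum>i=0..n. e i)"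
        by (intro sum_strict_mono_ex1 bexI[of _ i]) (use ge in \<open>auto simp: le_less\<close>)
      with e show False by simp
    qed
    then obtain i where i: "i \<le> n" "e i < d i" by blast
    show ?thesis
    proof (cases "i = 0")
      case True
      then have "monom 1 (e 0) div W = 0"
        using i W by (intro div_poly_less) (simp add: degree_monom_eq)
      then show ?thesis using val False by simp
    next
      case False': False
      then have "?s i = 0"
        using sum_node_weight_power[of "C i" "d i" "e i"] C[of i] i by simp
      moreover have "i \<in> {1..n}" using i False' by auto
      ultimately have "(\<Prod>l=1..n. ?s l) = 0" by (intro prod_zero) auto
      with val False show ?thesis by (simp only: mult_zero_left if_False)
    qed
  qed
qed

lemma prod_power_increment:
  fixes x :: "nat \<Rightarrow> 'a::comm_monoid_mult"
  assumes "j \<le> n"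
  shows "x j * (\<Prod>i\<in>{0..n}. x i ^ e i) = (\<Prod>i\<in>{0..n}. x i ^ (e(j := Suc (e j))) i)"
  using assms by (simp add: prod.remove[of "{0..n}" j] mult.assoc)

lemma sum_increment:
  assumes "j \<le> (n::nat)"
  shows "(\<Sum>i=0..n. (e(j := Suc (e j))) i) = Suc (\<Sum>i=0..n. e i)"
  using assms by (simp add: sum.remove[of "{0..n}" j])

text \<open>
  Homogeneity: expanding the product only produces monomials of one total degree.
\<close>

lemma lookup_product_wrong_degree:
  assumes "finite A" and "\<And>\<alpha>. \<alpha> \<in> A \<Longrightarrow> I \<alpha> \<le> n \<and> J \<alpha> \<le> n"
    and "(\<Sum>i=0..n. e i) + card A \<noteq> (\<Sum>i=0..n. d i)"
  shows "Poly_Mapping.lookup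
           ((\<Prod>i\<in>{0..n}. lvar i ^ e i) * (\<Prod>\<alpha>\<in>A. lvar (J \<alpha>) - lvar (I \<alpha>)))
           (monomial_exponent n d) = 0"
  using assms
proof (induction A arbitrary: e rule: finite_induct)
  case empty
  have "\<not> (\<forall>i\<le>n. e i = d i)"
  proof
    assume "\<forall>i\<le>n. e i = d i"
    then have "(\<Sum>i=0..n. e i) = (\<Sum>i=0..n. d i)" by (intro sum.cong) auto
    with empty show False by simp
  qed
  then show ?case by (simp add: lookup_prod_lvar)
next
  case (insert \<alpha> A)
  have \<alpha>: "I \<alpha> \<le> n" "J \<alpha> \<le> n" using insert.prems(1) by auto
  let ?P = "\<Prod>\<alpha>\<in>A. lvar (J \<alpha>) - lvar (I \<alpha>)"
  have "Poly_Mapping.lookup ((\<Prod>i\<in>{0..n}. lvar i ^ (e(j := Suc (e j))) i) * ?P)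
          (monomial_exponent n d) = 0" if "j \<le> n" for j
    using insert that by (intro insert.IH) (auto simp: sum_increment simp del: fun_upd_apply)
  from this[OF \<alpha>(1)] this[OF \<alpha>(2)] show ?case
    using insert.hyps \<alpha>
    by (simp add: lookup_minus left_diff_distrib right_diff_distrib
        prod_power_increment [symmetric] mult_ac del: fun_upd_apply)
qed

text \<open>
  The step that makes the shifts \<open>T \<alpha>\<close> invisible. Expanding one factor \<open>x\<^sub>j - x\<^sub>i - t\<close> gives two terms that
  match those of the unshifted factor \<open>x\<^sub>j - x\<^sub>i\<close> and a third one, \<open>- t\<close> times the remaining product,
  whose total degree is too small to have the coefficient at \<open>d\<close>. The monomial in front carries the
  variables already multiplied out.
\<close>

lemma grid_functional_product:
  assumes "finite A" and "\<And>\<alpha>. \<alpha> \<in> A \<Longrightarrow> I \<alpha> \<le> n \<and> J \<alpha> \<le> n"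
    and C: "\<And>l. l \<in> {1..n} \<Longrightarrow> finite (C l) \<and> card (C l) = Suc (d l)"
    and W: "lead_coeff W = 1" "degree W = d 0"
    and "(\<Sum>i=0..n. e i) + card A \<le> (\<Sum>i=0..n. d i)"
  shows "grid_functional W n C
           (\<lambda>x. (\<Prod>i\<in>{0..n}. x i ^ e i) * (\<Prod>\<alpha>\<in>A. x (J \<alpha>) - x (I \<alpha>) - [:T \<alpha>:]))
       = Poly_Mapping.lookup
           ((\<Prod>i\<in>{0..n}. lvar i ^ e i) * (\<Prod>\<alpha>\<in>A. lvar (J \<alpha>) - lvar (I \<alpha>)))
           (monomial_exponent n d)"
  using assms(1,2,6)
proof (induction A arbitrary: e rule: finite_induct)
  case empty
  then show ?case
    using grid_functional_monomial[of n C d W e] C W by (simp add: lookup_prod_lvar)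
next
  case (insert \<alpha> A)
  have \<alpha>: "I \<alpha> \<le> n" "J \<alpha> \<le> n" using insert.prems(1) by auto
  let ?P = "\<Prod>\<alpha>\<in>A. lvar (J \<alpha>) - lvar (I \<alpha>)"
  let ?F = "\<lambda>e x. (\<Prod>i\<in>{0..n}. x i ^ e i) * (\<Prod>\<alpha>\<in>A. x (J \<alpha>) - x (I \<alpha>) - [:T \<alpha>:])"
  let ?L = "\<lambda>e. Poly_Mapping.lookup ((\<Prod>i\<in>{0..n}. lvar i ^ e i) * ?P) (monomial_exponent n d)"
  have raised: "grid_functional W n C (\<lambda>x. x j * ?F e x)
      = Poly_Mapping.lookup (lvar j * ((\<Prod>i\<in>{0..n}. lvar i ^ e i) * ?P)) (monomial_exponent n d)"
    if "j \<le> n" for j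
  proof -
    have "grid_functional W n C (?F (e(j := Suc (e j)))) = ?L (e(j := Suc (e j)))"
      using insert that by (intro insert.IH) (auto simp: sum_increment simp del: fun_upd_apply)
    then show ?thesis
      by (simp only: prod_power_increment[OF that, symmetric] mult.assoc)
  qed
  have "grid_functional W n C (?F e) = ?L e"
    using insert by (intro insert.IH) auto
  also have "\<dots> = 0"
    using insert by (intro lookup_product_wrong_degree) auto
  finally have lower: "grid_functional W n C (?F e) = 0" .
  have "grid_functional W n C
          (\<lambda>x. (\<Prod>i\<in>{0..n}. x i ^ e i) * (\<Prod>\<alpha>\<in>insert \<alpha> A. x (J \<alpha>) - x (I \<alpha>) - [:T \<alpha>:]))
      = grid_functional W n C (\<lambda>x. (x (J \<alpha>) - x (I \<alpha>) - [:T \<alpha>:]) * ?F e x)"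
    using insert.hyps by (simp add: mult_ac)
  also have "\<dots> = Poly_Mapping.lookup (lvar (J \<alpha>) * ((\<Prod>i\<in>{0..n}. lvar i ^ e i) * ?P)) (monomial_exponent n d)
      - Poly_Mapping.lookup (lvar (I \<alpha>) * ((\<Prod>i\<in>{0..n}. lvar i ^ e i) * ?P)) (monomial_exponent n d)"
    unfolding grid_functional_difference lower raised[OF \<alpha>(1)] raised[OF \<alpha>(2)] by simp
  also have "\<dots> = Poly_Mapping.lookup
      ((\<Prod>i\<in>{0..n}. lvar i ^ e i) * (\<Prod>\<alpha>\<in>insert \<alpha> A. lvar (J \<alpha>) - lvar (I \<alpha>)))
      (monomial_exponent n d)"
    using insert.hyps by (simp add: lookup_minus [symmetric] algebra_simps)
  finally show ?case .
qed

text \<open>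
  The asymmetry between \<open>i < j\<close> and \<open>i > j\<close> makes the forbidden differences of a pair
  \<open>p < q\<close>, namely \<open>{- m..m - 1}\<close> for \<open>x\<^sub>q - x\<^sub>p\<close> when both exponents are \<open>m\<close>, a block of consecutive
  integers without repetition. It breaks ties in favour of increasing order of the indices.
\<close>

definition shifts :: "nat \<Rightarrow> nat \<Rightarrow> nat \<Rightarrow> int set" where
  "shifts i j m = (if i < j then {0..<int m} else {1..int m})"

lemma finite_shifts [simp]: "finite (shifts i j m)" and card_shifts [simp]: "card (shifts i j m) = m"
  by (simp_all add: shifts_def)

definition shifted_kernel ::
    "(nat \<Rightarrow> nat \<Rightarrow> nat) \<Rightarrow> nat \<Rightarrow> (nat \<Rightarrow> rat poly) \<Rightarrow> rat poly" where
  "shifted_kernel m n x =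
     (\<Prod>(i, j)\<in>off_diag 0 n. \<Prod>t\<in>shifts i j (m i j). x j - x i - [:of_int t:])"

theorem CT_eq_grid_functional:
  assumes C: "\<And>l. l \<in> {1..n} \<Longrightarrow> finite (C l) \<and> card (C l) = Suc (\<Sum>i\<in>{0..n}-{l}. m i l)"
    and W: "lead_coeff W = 1" "degree W = (\<Sum>i=1..n. m i 0)"
  shows "CT (\<Prod>(i, j)\<in>off_diag 0 n. (1 - lratio i j) ^ m i j)
       = grid_functional W n C (shifted_kernel m n)"
proof -
  define A where "A = (SIGMA p:off_diag 0 n. shifts (fst p) (snd p) (m (fst p) (snd p)))"
  define d where "d = (\<lambda>j. \<Sum>i\<in>{0..n}-{j}. m i j)"
  have fin: "finite A" by (auto simp: A_def)
  have "card A = (\<Sum>(i, j)\<in>off_diag 0 n. m i j)"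
    unfolding A_def by (subst card_SigmaI) (auto simp: case_prod_beta)
  also have "\<dots> = (\<Sum>j=0..n. d j)"
  proof -
    have eq: "off_diag 0 n = prod.swap ` (SIGMA j:{0..n}. {0..n} - {j})"
      by (auto simp: off_diag_def image_iff)
    show ?thesis unfolding eq d_def
      by (subst sum.reindex) (auto simp: case_prod_beta sum.Sigma)
  qed
  finally have card: "card A = (\<Sum>j=0..n. d j)" .
  have kernel: "shifted_kernel m n x
      = (\<Prod>\<alpha>\<in>A. x (snd (fst \<alpha>)) - x (fst (fst \<alpha>)) - [:of_int (snd \<alpha>):])" for x
    unfolding shifted_kernel_def A_def
    by (simp add: prod.Sigma case_prod_beta)
  have laurent: "(\<Prod>(i, j)\<in>off_diag 0 n. (lvar j - lvar i) ^ m i j)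
      = (\<Prod>\<alpha>\<in>A. lvar (snd (fst \<alpha>)) - lvar (fst (fst \<alpha>)))"
    using prod.Sigma[of "off_diag 0 n" "\<lambda>p. shifts (fst p) (snd p) (m (fst p) (snd p))"
        "\<lambda>p _. lvar (snd p) - lvar (fst p)", symmetric]
    unfolding A_def by (simp add: case_prod_beta)
  have "d 0 = (\<Sum>i=1..n. m i 0)"
    unfolding d_def by (rule sum.cong) auto
  then show ?thesis
    using grid_functional_product[of A "\<lambda>\<alpha>. fst (fst \<alpha>)" n "\<lambda>\<alpha>. snd (fst \<alpha>)" C d W "\<lambda>_. 0" "\<lambda>\<alpha>. of_int (snd \<alpha>)"]
      fin card C W
    unfolding CT_eq_coefficient laurent kernel[abs_def] d_def
    by (auto simp: A_def off_diag_def)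
qed

section \<open>Separated integer points\<close>

text \<open>
  The least positions of \<open>n\<close> separated nonnegative integers whose first \<open>n0\<close> members, in increasing
  order, belong to light indices. The truncated difference \<open>i - n0\<close> counts the heavy members below
  position \<open>i\<close>.
\<close>

definition step_position :: "nat \<Rightarrow> nat \<Rightarrow> nat \<Rightarrow> nat" where
  "step_position n0 k i = i * k + (i - n0)"

text \<open>
  The exponent of the pair \<open>p, q \<ge> 1\<close> in the kernel, seen as a distance.
\<close>

definition min_gap :: "nat \<Rightarrow> nat \<Rightarrow> nat \<Rightarrow> nat \<Rightarrow> nat" where
  "min_gap n0 k p q = (if n0 < p \<and> n0 < q then k + 1 else k)"

text \<open>
  The condition under which no factor of a pair of indices in \<open>{1..n}\<close> vanishes. The second
  inequality is strict, which is the cost of placing the larger index below the smaller one.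
\<close>

definition separated :: "nat \<Rightarrow> nat \<Rightarrow> nat \<Rightarrow> (nat \<Rightarrow> int) \<Rightarrow> bool" where
  "separated n0 k n c \<longleftrightarrow> (\<forall>p\<in>{1..n}. \<forall>q\<in>{1..n}. p < q \<longrightarrow>
     c p + int (min_gap n0 k p q) \<le> c q \<or> c q + int (min_gap n0 k p q) < c p)"

text \<open>
  The points removed for light indices lie one above the upper end \<open>step_position n0 k i + b\<close> of
  the \<open>i\<close>-th window, for the positions \<open>i\<close> after which the staircase rises by \<open>k + 1\<close>. There are as many
  of them as the interval has superfluous points.
\<close>

definition grid_nodes :: "nat \<Rightarrow> nat \<Rightarrow> nat \<Rightarrow> nat \<Rightarrow> nat \<Rightarrow> int set" where
  "grid_nodes n0 k b n l = {0..int (step_position n0 k (n - 1) + b)} -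
     (if l \<le> n0 then (\<lambda>i. int (step_position n0 k i + b + 1)) ` {n0..<n - 1} else {})"

lemma step_position_Suc:
  "step_position n0 k (Suc i) = step_position n0 k i + (if n0 \<le> i then k + 1 else k)"
  by (cases "n0 \<le> i") (simp_all add: step_position_def Suc_diff_le)

lemma step_position_mono: "i \<le> j \<Longrightarrow> step_position n0 k i \<le> step_position n0 k j"
  unfolding step_position_def by (intro add_mono mult_le_mono1 diff_le_mono)

lemma step_position_less: "n0 \<le> i \<Longrightarrow> i < j \<Longrightarrow> step_position n0 k i < step_position n0 k j"
  using step_position_mono[of "Suc i" j n0 k] by (simp add: step_position_Suc)

lemma finite_grid_nodes [simp]: "finite (grid_nodes n0 k b n l)"
  by (simp add: grid_nodes_def)

lemma inj_on_step_position: "inj_on (\<lambda>i. int (step_position n0 k i + c)) {n0..<m}"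
proof (rule inj_onI)
  fix i j
  assume ij: "i \<in> {n0..<m}" "j \<in> {n0..<m}"
    "int (step_position n0 k i + c) = int (step_position n0 k j + c)"
  then have "\<not> i < j" "\<not> j < i"
    using step_position_less[of n0 i j k] step_position_less[of n0 j i k] by auto
  then show "i = j" by simp
qed

lemma excluded_nodes_bounded:
  assumes "n0 \<le> i" "i < n - 1"
  shows "step_position n0 k i + b + 1 \<le> step_position n0 k (n - 1) + b"
proof -
  have "step_position n0 k (Suc i) \<le> step_position n0 k (n - 1)"
    using assms by (intro step_position_mono) auto
  then show ?thesis using assms by (simp add: step_position_Suc)
qed

lemma card_grid_nodes:
  "card (grid_nodes n0 k b n l)
     = Suc (b + (n - 1) * k + (if l \<le> n0 then 0 else n - 1 - n0))"
proof -
  have top: "card {0..int (step_position n0 k (n - 1) + b)} = Suc (step_position n0 k (n - 1) + b)"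
    by simp
  show ?thesis
  proof (cases "l \<le> n0")
    case True
    let ?E = "(\<lambda>i. int (step_position n0 k i + (b + 1))) ` {n0..<n - 1}"
    have sub: "?E \<subseteq> {0..int (step_position n0 k (n - 1) + b)}"
    proof
      fix x assume "x \<in> ?E"
      then obtain i where i: "n0 \<le> i" "i < n - 1" and x: "x = int (step_position n0 k i + (b + 1))"
        by auto
      show "x \<in> {0..int (step_position n0 k (n - 1) + b)}"
        using excluded_nodes_bounded[OF i, of k b] unfolding x by simp
    qed
    have "card ?E = n - 1 - n0"
      by (subst card_image[OF inj_on_step_position]) simp
    then have "card (grid_nodes n0 k b n l) = Suc (step_position n0 k (n - 1) + b) - (n - 1 - n0)"
      using True card_Diff_subset[OF _ sub] top by (simp only: grid_nodes_def add.assoc finite_imageI finite_atLeastLessThan if_True)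
    with True show ?thesis by (simp add: step_position_def)
  next
    case False
    then have "card (grid_nodes n0 k b n l) = Suc (step_position n0 k (n - 1) + b)"
      using top by (simp only: grid_nodes_def if_False Diff_empty)
    with False show ?thesis by (simp add: step_position_def)
  qed
qed

text \<open>
  In increasing order of the values, neighbours keep the minimal gap, plus one where the index decreases.
  Equal values can occur for \<open>k = 0\<close>, and then the indices must increase. So the points are sorted
  lexicographically by value and index.
\<close>

lemma separated_sort:
  assumes sep: "separated n0 k n c" and nonneg: "\<And>l. l \<in> {1..n} \<Longrightarrow> 0 \<le> c l"
  obtains \<sigma> where "bij_betw \<sigma> {..<n} {1..n}"
    and "\<And>i. Suc i < n \<Longrightarrow>
      c (\<sigma> i) + int (min_gap n0 k (\<sigma> i) (\<sigma> (Suc i))) + (if \<sigma> (Suc i) < \<sigma> i then 1 else 0)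
        \<le> c (\<sigma> (Suc i))"
proof -
  \<comment> \<open>As \<open>l \<le> n\<close>, comparing keys is comparing the pairs \<open>(c l, l)\<close> lexicographically.\<close>
  define key where "key l = nat (c l) * Suc n + l" for l
  have key_less: "c p < c q \<or> c p = c q \<and> p < q"
    if "p \<in> {1..n}" "q \<in> {1..n}" "key p < key q" for p q
  proof (rule ccontr)
    assume neg: "\<not> ?thesis"
    show False
    proof (cases "c p = c q")
      case True
      then show False using neg that(3) unfolding key_def by simp
    next
      case False
      with neg have "c q < c p" by simp
      then have "Suc (nat (c q)) \<le> nat (c p)" using nonneg[OF that(2)] by linarith
      then have "Suc (nat (c q)) * Suc n \<le> nat (c p) * Suc n" by (rule mult_le_mono1)
      moreover have "q < Suc n" using that(2) by simp
      ultimately show False using that(3) unfolding key_def mult_Suc by linarith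
    qed
  qed
  have inj: "inj_on key {1..n}"
  proof (rule inj_onI)
    fix p q assume pq: "p \<in> {1..n}" "q \<in> {1..n}" "key p = key q"
    have "key l mod Suc n = l mod Suc n" for l
      unfolding key_def by (rule mod_mult_self3)
    then have "p mod Suc n = q mod Suc n" using pq(3) by metis
    with pq show "p = q" by simp
  qed
  have "finite (key ` {1..n})" by simp
  then obtain h where h: "bij_betw h {..<card (key ` {1..n})} (key ` {1..n})"
    "strict_mono_on {..<card (key ` {1..n})} h"
    by (rule ex_bij_betw_strict_mono_card)
  have sepD: "c p + int (min_gap n0 k p q) \<le> c q \<or> c q + int (min_gap n0 k p q) < c p"
    if "p \<in> {1..n}" "q \<in> {1..n}" "p < q" for p q
    using sep that unfolding separated_def by blast
  have card: "card (key ` {1..n}) = n" using inj by (simp add: card_image)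
  define \<sigma> where "\<sigma> = the_inv_into {1..n} key \<circ> h"
  have bij: "bij_betw \<sigma> {..<n} {1..n}"
  proof -
    have "bij_betw key {1..n} (key ` {1..n})" using inj by (simp add: bij_betw_def)
    then have "bij_betw (the_inv_into {1..n} key) (key ` {1..n}) {1..n}"
      by (rule bij_betw_the_inv_into)
    from bij_betw_trans[OF h(1) this] show ?thesis unfolding \<sigma>_def card .
  qed
  have key\<sigma>: "key (\<sigma> i) = h i" if "i < n" for i
  proof -
    have "h i \<in> key ` {1..n}" using that bij_betw_apply[OF h(1)] card by simp
    from f_the_inv_into_f[OF inj this] show ?thesis unfolding \<sigma>_def comp_apply .
  qed
  have in_range: "\<sigma> i \<in> {1..n}" if "i < n" for i
    using bij that by (auto simp: bij_betw_def)
  show ?thesis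
  proof (rule that[OF bij])
    fix i assume i: "Suc i < n"
    let ?p = "\<sigma> i" and ?q = "\<sigma> (Suc i)"
    have pq: "?p \<in> {1..n}" "?q \<in> {1..n}" using in_range i by auto
    have "key ?p < key ?q"
      unfolding key\<sigma>[OF i] key\<sigma>[OF Suc_lessD[OF i]]
      using strict_mono_onD[OF h(2), of i "Suc i"] i card by simp
    then have less: "c ?p < c ?q \<or> c ?p = c ?q \<and> ?p < ?q" by (rule key_less[OF pq])
    have gap: "min_gap n0 k ?q ?p = min_gap n0 k ?p ?q" by (auto simp: min_gap_def)
    have "?p \<noteq> ?q" using less by auto
    then consider "?p < ?q" | "?q < ?p" by linarith
    then show "c ?p + int (min_gap n0 k ?p ?q) + (if ?q < ?p then 1 else 0) \<le> c ?q"
    proof cases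
      case 1
      then show ?thesis using sepD[OF pq 1] less by auto
    next
      case 2
      then show ?thesis using sepD[OF pq(2,1) 2] less gap by auto
    qed
  qed
qed

text \<open>
  A separated point sorted increasingly: position \<open>i\<close> is occupied by the index \<open>\<sigma> i\<close> and has the
  value \<open>y i\<close>.
\<close>

locale separated_chain =
  fixes n0 k n :: nat and \<sigma> :: "nat \<Rightarrow> nat" and y :: "nat \<Rightarrow> int"
  assumes n0: "n0 \<le> n"
    and bij: "bij_betw \<sigma> {..<n} {1..n}"
    and gap: "\<And>i. Suc i < n \<Longrightarrow>
      y i + int (min_gap n0 k (\<sigma> i) (\<sigma> (Suc i))) + (if \<sigma> (Suc i) < \<sigma> i then 1 else 0) \<le> y (Suc i)"
begin

lemma gap_ge: "Suc i < n \<Longrightarrow> y i + int k \<le> y (Suc i)"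
  using gap[of i] by (auto simp: min_gap_def split: if_splits)

text \<open>
  A heavy index costs an extra unit whatever comes next: with a heavy successor the minimal gap is
  \<open>k + 1\<close>, and a light successor is a descent of the index.
\<close>

lemma gap_ge_Suc: "Suc i < n \<Longrightarrow> n0 < \<sigma> i \<Longrightarrow> y i + int k + 1 \<le> y (Suc i)"
  using gap[of i] by (auto simp: min_gap_def split: if_splits)

lemma inj_\<sigma>: "inj_on \<sigma> {..<n}" and \<sigma>_range: "i < n \<Longrightarrow> \<sigma> i \<in> {1..n}"
  using bij by (auto simp: bij_betw_def)

lemma card_small_labels: "i \<le> n \<Longrightarrow> card {j. j < i \<and> \<sigma> j \<le> n0} \<le> n0"
proof -
  assume i: "i \<le> n"
  have "card {j. j < i \<and> \<sigma> j \<le> n0} \<le> card {1..n0}"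
  proof (rule card_inj_on_le)
    show "inj_on \<sigma> {j. j < i \<and> \<sigma> j \<le> n0}"
      using i by (auto intro: inj_on_subset[OF inj_\<sigma>])
    show "\<sigma> ` {j. j < i \<and> \<sigma> j \<le> n0} \<subseteq> {1..n0}"
      using i \<sigma>_range by force
  qed simp
  then show ?thesis by simp
qed

text \<open>
  Each heavy index below position \<open>i\<close> costs an extra unit, and at most \<open>n0\<close> of the \<open>i\<close> indices below
  are light.
\<close>

lemma chain_lower:
  assumes "i < n"
  shows "y 0 + int (step_position n0 k i) \<le> y i"
proof -
  have count: "y 0 + int (i * k + card {j. j < i \<and> n0 < \<sigma> j}) \<le> y i" if "i < n" for i
    using that
  proof (induction i)
    case 0
    then show ?case by simp
  next
    case (Suc i)
    show ?case
    proof (cases "n0 < \<sigma> i")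
      case True
      then have "{j. j < Suc i \<and> n0 < \<sigma> j} = insert i {j. j < i \<and> n0 < \<sigma> j}"
        by (auto simp: less_Suc_eq)
      then show ?thesis using Suc gap_ge_Suc[of i] True by simp
    next
      case False
      then have "{j. j < Suc i \<and> n0 < \<sigma> j} = {j. j < i \<and> n0 < \<sigma> j}"
        by (auto simp: less_Suc_eq)
      then show ?thesis using Suc gap_ge[of i] by simp
    qed
  qed
  \<comment> \<open>at least \<open>i - n0\<close> of the positions below \<open>i\<close> are occupied by heavy indices\<close>
  have "card {..<i} = card ({j. j < i \<and> \<sigma> j \<le> n0} \<union> {j. j < i \<and> n0 < \<sigma> j})"
    by (rule arg_cong[of _ _ card]) auto
  also have "\<dots> = card {j. j < i \<and> \<sigma> j \<le> n0} + card {j. j < i \<and> n0 < \<sigma> j}"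
    by (rule card_Un_disjoint) auto
  finally have "i - n0 \<le> card {j. j < i \<and> n0 < \<sigma> j}"
    using card_small_labels[of i] assms by simp
  with count[OF assms] show ?thesis by (simp add: step_position_def)
qed

text \<open>
  Downward induction from the top. In the lower part of the staircase its steps are \<open>k\<close>, the
  guaranteed gap. In the upper part they are \<open>k + 1\<close>, and only above a light index can the gap be smaller.
  Such an index overshoots its window by at most one, and the point in question is excluded.
\<close>

lemma chain_upper:
  assumes top: "y (n - 1) \<le> int (step_position n0 k (n - 1) + b)"
    and excl: "\<And>i j. \<lbrakk>i < n; \<sigma> i \<le> n0; n0 \<le> j; j < n - 1\<rbrakk> \<Longrightarrow> y i \<noteq> int (step_position n0 k j + b + 1)"
    and "i < n"
  shows "y i \<le> int (step_position n0 k i + b)"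
proof -
  have "i \<le> n - 1" using assms(3) by simp
  then show ?thesis
  proof (induction i rule: inc_induct)
    case base
    then show ?case by (rule top)
  next
    case (step i)
    then have i: "Suc i < n" by simp
    show ?case
    proof (cases "n0 \<le> i \<and> \<sigma> i \<le> n0")
      case True
      then have "y i \<noteq> int (step_position n0 k i + b + 1)" using excl i by auto
      moreover have "y i \<le> int (step_position n0 k i + b + 1)"
        using gap_ge[OF i] step.IH True by (simp add: step_position_Suc)
      ultimately show ?thesis by simp
    next
      case False
      then show ?thesis
        using gap_ge[OF i] gap_ge_Suc[OF i] step.IH by (auto simp: step_position_Suc split: if_splits)
    qed
  qed
qed

text \<open>
  When all gaps are those of the staircase, a gap \<open>k\<close> leaves no room for a heavy index or for a
  descent, so the light indices fill the first \<open>n0\<close> positions. The gaps \<open>k + 1\<close> above lie between heavy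
  indices, where \<open>k + 1\<close> is already the minimum, so there is no descent there either.
\<close>

lemma tight_chain_sorted:
  assumes tight: "\<And>i. i < n \<Longrightarrow> y i = int (step_position n0 k i + b)" and "i < n"
  shows "\<sigma> i = Suc i"
proof -
  have low: "\<sigma> i \<le> n0 \<and> \<sigma> i < \<sigma> (Suc i)" if "i < n0" "Suc i < n" for i
  proof -
    have "y (Suc i) = y i + int k" using tight that by (simp add: step_position_Suc)
    moreover have "\<sigma> i \<noteq> \<sigma> (Suc i)" using inj_onD[OF inj_\<sigma>, of i "Suc i"] that by auto
    ultimately show ?thesis
      using gap[OF that(2)] gap_ge_Suc[OF that(2)] by (auto simp: min_gap_def split: if_splits)
  qed
  have low_image: "\<sigma> ` {..<n0} = {1..n0}"
  proof (rule card_seteq)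
    have "\<sigma> i \<in> {1..n0}" if "i < n0" for i
    proof (cases "Suc i < n")
      case True
      then show ?thesis using low[OF that] \<sigma>_range[of i] by auto
    next
      case False
      then have "n0 = n" using that n0 by simp
      then show ?thesis using \<sigma>_range[of i] that by simp
    qed
    then show "\<sigma> ` {..<n0} \<subseteq> {1..n0}" by auto
    have "card (\<sigma> ` {..<n0}) = n0"
      using n0 by (subst card_image) (auto intro: inj_on_subset[OF inj_\<sigma>])
    then show "card {1..n0} \<le> card (\<sigma> ` {..<n0})" by simp
  qed simp
  have high: "n0 < \<sigma> i" if "n0 \<le> i" "i < n" for i
  proof (rule ccontr)
    assume "\<not> n0 < \<sigma> i"
    then have "\<sigma> i \<in> \<sigma> ` {..<n0}" using \<sigma>_range[OF that(2)] low_image by auto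
    then obtain j where "j < n0" "\<sigma> j = \<sigma> i" by force
    with that n0 show False using inj_onD[OF inj_\<sigma>, of j i] by auto
  qed
  have mono: "\<sigma> i < \<sigma> (Suc i)" if "Suc i < n" for i
  proof (cases "i < n0")
    case True
    then show ?thesis using low that by blast
  next
    case False
    have "y (Suc i) = y i + int k + 1" using tight that False by (simp add: step_position_Suc)
    moreover have "\<sigma> i \<noteq> \<sigma> (Suc i)" using inj_onD[OF inj_\<sigma>, of i "Suc i"] that by auto
    ultimately show ?thesis
      using gap[OF that] high[of i] high[of "Suc i"] False that
      by (auto simp: min_gap_def split: if_splits)
  qed
  have lower: "Suc i \<le> \<sigma> i" if "i < n" for i
    using that
  proof (induction i)
    case 0
    then show ?case using \<sigma>_range[of 0] by auto
  next
    case (Suc i)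
    then show ?case using mono[of i] by simp
  qed
  have upper: "\<sigma> i \<le> Suc i" if "i < n" for i
  proof -
    have "i \<le> n - 1" using that by simp
    then show ?thesis
    proof (induction i rule: inc_induct)
      case base
      then show ?case using \<sigma>_range[of "n - 1"] that by auto
    next
      case (step m)
      then show ?case using mono[of m] by linarith
    qed
  qed
  show ?thesis using lower upper assms(2) by (simp add: le_antisym)
qed

end

lemma separated_grid_windows:
  assumes n: "n0 \<le> n" and sep: "separated n0 k n c" and c: "c \<in> PiE {1..n} (grid_nodes n0 k b n)"
  obtains \<sigma> where "bij_betw \<sigma> {..<n} {1..n}"
    and "\<And>i. i < n \<Longrightarrow> int (step_position n0 k i) \<le> c (\<sigma> i) \<and> c (\<sigma> i) \<le> int (step_position n0 k i + b)"
    and "(\<forall>l\<in>{1..n}. int b \<le> c l) \<Longrightarrow>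
      (\<forall>i<n. \<sigma> i = Suc i \<and> c (\<sigma> i) = int (step_position n0 k i + b))"
proof -
  have node: "c l \<in> grid_nodes n0 k b n l" if "l \<in> {1..n}" for l
    using c that by (auto simp: PiE_iff)
  then have nonneg: "0 \<le> c l" if "l \<in> {1..n}" for l
    using that by (auto simp: grid_nodes_def)
  obtain \<sigma> where bij: "bij_betw \<sigma> {..<n} {1..n}"
    and gap: "\<And>i. Suc i < n \<Longrightarrow>
      c (\<sigma> i) + int (min_gap n0 k (\<sigma> i) (\<sigma> (Suc i))) + (if \<sigma> (Suc i) < \<sigma> i then 1 else 0)
        \<le> c (\<sigma> (Suc i))"
    using separated_sort[OF sep nonneg] by blast
  interpret separated_chain n0 k n \<sigma> "\<lambda>i. c (\<sigma> i)"
    using n bij gap by unfold_locales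
  have lower: "int (step_position n0 k i) \<le> c (\<sigma> i)" if "i < n" for i
    using chain_lower[OF that] nonneg[OF \<sigma>_range[of 0]] that by simp
  have upper: "c (\<sigma> i) \<le> int (step_position n0 k i + b)" if "i < n" for i
  proof (rule chain_upper[OF _ _ that])
    show "c (\<sigma> (n - 1)) \<le> int (step_position n0 k (n - 1) + b)"
      using node[OF \<sigma>_range[of "n - 1"]] that by (auto simp: grid_nodes_def)
    show "c (\<sigma> i) \<noteq> int (step_position n0 k j + b + 1)"
      if "i < n" "\<sigma> i \<le> n0" "n0 \<le> j" "j < n - 1" for i j
      using node[OF \<sigma>_range[OF that(1)]] that by (auto simp: grid_nodes_def)
  qed
  show ?thesis
  proof (rule that[OF bij])
    show "\<And>i. i < n \<Longrightarrow> int (step_position n0 k i) \<le> c (\<sigma> i) \<and> c (\<sigma> i) \<le> int (step_position n0 k i + b)"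
      using lower upper by blast
    assume ge: "\<forall>l\<in>{1..n}. int b \<le> c l"
    have tight: "c (\<sigma> i) = int (step_position n0 k i + b)" if "i < n" for i
      using chain_lower[OF that] bspec[OF ge \<sigma>_range[of 0]] upper[OF that] that by simp
    show "\<forall>i<n. \<sigma> i = Suc i \<and> c (\<sigma> i) = int (step_position n0 k i + b)"
      using tight_chain_sorted[of b, OF tight] tight by blast
  qed
qed

section \<open>The single surviving grid point\<close>

definition forrester_exponent :: "nat \<Rightarrow> nat \<Rightarrow> nat \<Rightarrow> nat \<Rightarrow> nat \<Rightarrow> nat \<Rightarrow> nat" where
  "forrester_exponent n0 a b k i j = (if j = 0 then a else if i = 0 then b else min_gap n0 k i j)"

lemma prod_off_diag_0:
  fixes f :: "nat \<times> nat \<Rightarrow> 'a::comm_monoid_mult"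
  shows "(\<Prod>p\<in>off_diag 0 n. f p) = (\<Prod>l=1..n. f (0, l) * f (l, 0)) * (\<Prod>p\<in>off_diag 1 n. f p)"
proof -
  have split: "off_diag 0 n = (Pair 0 ` {1..n} \<union> (\<lambda>l. (l, 0)) ` {1..n}) \<union> off_diag 1 n"
    by (auto simp: off_diag_def image_iff)
  have "(\<Prod>p\<in>off_diag 0 n. f p)
      = (\<Prod>p\<in>Pair 0 ` {1..n} \<union> (\<lambda>l. (l, 0)) ` {1..n}. f p) * (\<Prod>p\<in>off_diag 1 n. f p)"
    unfolding split
    by (intro prod.union_disjoint finite_UnI finite_imageI finite_off_diag finite_atLeastAtMost)
      (auto simp: off_diag_def)
  also have "(\<Prod>p\<in>Pair 0 ` {1..n} \<union> (\<lambda>l. (l, 0)) ` {1..n}. f p)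
      = (\<Prod>p\<in>Pair 0 ` {1..n}. f p) * (\<Prod>p\<in>(\<lambda>l. (l, 0)) ` {1..n}. f p)"
    by (rule prod.union_disjoint) auto
  also have "\<dots> = (\<Prod>l=1..n. f (0, l)) * (\<Prod>l=1..n. f (l, 0))"
    by (simp add: prod.reindex inj_on_def)
  finally show ?thesis by (simp add: prod.distrib)
qed

definition linear_factors :: "int set \<Rightarrow> rat poly" where
  "linear_factors S = (\<Prod>r\<in>S. [:- of_int r, 1:])"

lemma poly_linear_factors: "poly (linear_factors S) 0 = (\<Prod>r\<in>S. - of_int r)"
  by (simp add: linear_factors_def poly_prod)

lemma lead_coeff_linear_factors: "lead_coeff (linear_factors S) = 1"
  unfolding linear_factors_def lead_coeff_prod by simp

lemma degree_linear_factors: "finite S \<Longrightarrow> degree (linear_factors S) = card S"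
  by (simp add: linear_factors_def degree_prod_sum_eq)

definition anchor_factor :: "nat \<Rightarrow> nat \<Rightarrow> int \<Rightarrow> rat poly" where
  "anchor_factor a b y = smult ((-1) ^ b) (linear_factors {y - int b + 1..y + int a})"

text \<open>
  The factors pairing \<open>x\<^sub>0\<close> with one other variable at the value \<open>y\<close>, as a polynomial in \<open>x\<^sub>0\<close>: the
  shifts of the two orders of the pair join to one interval of \<open>a + b\<close> roots.
\<close>

lemma anchor_factor_eq:
  assumes "0 < l"
  shows "(\<Prod>t\<in>shifts 0 l b. [:of_int y:] - [:0, 1:] - [:of_int t:])
       * (\<Prod>t\<in>shifts l 0 a. [:0, 1:] - [:of_int y:] - [:of_int t:]) = anchor_factor a b y"
proof -
  have "(\<Prod>t\<in>shifts 0 l b. [:of_int y:] - [:0, 1:] - [:of_int t:])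
      = (\<Prod>t\<in>{0..<int b}. [:-1:] * [:- of_int (y - t), 1 :: rat:])"
    using assms by (simp add: shifts_def)
  also have "\<dots> = smult ((-1) ^ b) (\<Prod>t\<in>{0..<int b}. [:- of_int (y - t), 1 :: rat:])"
    unfolding prod.distrib by (simp add: poly_const_pow)
  also have "(\<Prod>t\<in>{0..<int b}. [:- of_int (y - t), 1 :: rat:]) = linear_factors {y - int b + 1..y}"
    unfolding linear_factors_def
    by (rule prod.reindex_bij_witness[where i = "\<lambda>r. y - r" and j = "\<lambda>t. y - t"]) auto
  finally have 1: "(\<Prod>t\<in>shifts 0 l b. [:of_int y:] - [:0, 1:] - [:of_int t:])
      = smult ((-1) ^ b) (linear_factors {y - int b + 1..y})" .
  have "(\<Prod>t\<in>shifts l 0 a. [:0, 1:] - [:of_int y:] - [:of_int t:])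
      = (\<Prod>t\<in>{1..int a}. [:- of_int (y + t), 1 :: rat:])"
    using assms by (simp add: shifts_def)
  also have "\<dots> = linear_factors {y + 1..y + int a}"
    unfolding linear_factors_def
    by (rule prod.reindex_bij_witness[where i = "\<lambda>r. r - y" and j = "\<lambda>t. y + t"]) auto
  finally have 2: "(\<Prod>t\<in>shifts l 0 a. [:0, 1:] - [:of_int y:] - [:of_int t:])
      = linear_factors {y + 1..y + int a}" .
  have "linear_factors {y - int b + 1..y + int a}
      = linear_factors {y - int b + 1..y} * linear_factors {y + 1..y + int a}"
    unfolding linear_factors_def
    by (subst prod.union_disjoint [symmetric]) (auto intro!: prod.cong)
  then show ?thesis unfolding 1 2 anchor_factor_def by simp
qed

definition pair_factor :: "nat \<Rightarrow> nat \<Rightarrow> nat \<Rightarrow> (nat \<Rightarrow> int) \<Rightarrow> rat" where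
  "pair_factor n0 k n c =
     (\<Prod>(i, j)\<in>off_diag 1 n. \<Prod>t\<in>shifts i j (min_gap n0 k i j). of_int (c j - c i - t))"

lemma pair_factor_separated:
  assumes "pair_factor n0 k n c \<noteq> 0"
  shows "separated n0 k n c"
  unfolding separated_def
proof (intro ballI impI)
  fix p q assume pq: "p \<in> {1..n}" "q \<in> {1..n}" "p < q"
  have nz: "c j - c i \<notin> shifts i j (min_gap n0 k i j)" if "(i, j) \<in> off_diag 1 n" for i j
  proof
    assume "c j - c i \<in> shifts i j (min_gap n0 k i j)"
    then have "(\<Prod>t\<in>shifts i j (min_gap n0 k i j). of_int (c j - c i - t) :: rat) = 0"
      by (intro prod_zero) (auto intro!: bexI[of _ "c j - c i"])
    with that have "pair_factor n0 k n c = 0"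
      unfolding pair_factor_def by (intro prod_zero) (auto intro!: bexI[of _ "(i, j)"])
    with assms show False by simp
  qed
  have "min_gap n0 k q p = min_gap n0 k p q" by (simp add: min_gap_def)
  moreover have "(p, q) \<in> off_diag 1 n" "(q, p) \<in> off_diag 1 n" using pq by (auto simp: off_diag_def)
  ultimately show "c p + int (min_gap n0 k p q) \<le> c q \<or> c q + int (min_gap n0 k p q) < c p"
    using nz[of p q] nz[of q p] pq(3) by (auto simp: shifts_def)
qed

lemma shifted_kernel_grid_point:
  "shifted_kernel (forrester_exponent n0 a b k) n (grid_point c)
     = smult (pair_factor n0 k n c) (\<Prod>l=1..n. anchor_factor a b (c l))"
proof -
  let ?f = "\<lambda>p. \<Prod>t\<in>shifts (fst p) (snd p) (forrester_exponent n0 a b k (fst p) (snd p)).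
    grid_point c (snd p) - grid_point c (fst p) - [:of_int t:]"
  have "?f (0, l) * ?f (l, 0) = anchor_factor a b (c l)" if "0 < l" for l
    unfolding anchor_factor_eq[OF that, symmetric]
    using that by (simp add: forrester_exponent_def grid_point_def)
  then have "(\<Prod>l=1..n. ?f (0, l) * ?f (l, 0)) = (\<Prod>l=1..n. anchor_factor a b (c l))"
    by (intro prod.cong) auto
  moreover have "(\<Prod>p\<in>off_diag 1 n. ?f p) = [:pair_factor n0 k n c:]"
  proof -
    have const: "(\<Prod>x\<in>S. [:g x:]) = [:\<Prod>x\<in>S. g x :: rat:]" for S and g :: "'b \<Rightarrow> rat"
      by (induction S rule: infinite_finite_induct) (simp_all add: mult.commute one_pCons)
    have "(\<Prod>p\<in>off_diag 1 n. ?f p) = (\<Prod>p\<in>off_diag 1 n.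
        [:\<Prod>t\<in>shifts (fst p) (snd p) (min_gap n0 k (fst p) (snd p)).
          of_int (c (snd p) - c (fst p) - t):])"
    proof (rule prod.cong)
      fix p assume "p \<in> off_diag 1 n"
      then have "fst p \<noteq> 0" "snd p \<noteq> 0" by (auto simp: off_diag_def)
      then show "?f p = [:\<Prod>t\<in>shifts (fst p) (snd p) (min_gap n0 k (fst p) (snd p)).
          of_int (c (snd p) - c (fst p) - t):]"
        by (simp add: const [symmetric] forrester_exponent_def grid_point_def)
    qed simp
    then show ?thesis by (simp add: const pair_factor_def case_prod_beta)
  qed
  ultimately show ?thesis
    unfolding shifted_kernel_def case_prod_beta prod_off_diag_0 by simp
qed

text \<open>
  Its roots are those that every separated grid point is guaranteed to have: a value \<open>y\<close> in the window
  \<open>{s..s + b}\<close> gives the roots \<open>{y - b + 1..y + a}\<close>, and \<open>{s + 1..s + a}\<close> is their intersection over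
  all such \<open>y\<close>.
\<close>

definition anchor_modulus :: "nat \<Rightarrow> nat \<Rightarrow> nat \<Rightarrow> nat \<Rightarrow> rat poly" where
  "anchor_modulus n0 k a n =
     (\<Prod>i<n. linear_factors {int (step_position n0 k i) + 1..int (step_position n0 k i) + int a})"

lemma lead_coeff_anchor_modulus: "lead_coeff (anchor_modulus n0 k a n) = 1"
  unfolding anchor_modulus_def lead_coeff_prod lead_coeff_linear_factors by simp

lemma degree_anchor_modulus: "degree (anchor_modulus n0 k a n) = n * a"
proof -
  have "linear_factors S \<noteq> 0" for S using lead_coeff_linear_factors[of S] by auto
  then show ?thesis
    unfolding anchor_modulus_def by (subst degree_prod_sum_eq) (auto simp: degree_linear_factors)
qed

lemma poly_anchor_modulus_nonzero: "poly (anchor_modulus n0 k a n) 0 \<noteq> 0"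
  by (auto simp: anchor_modulus_def poly_prod poly_linear_factors prod_zero_iff)

lemma anchor_modulus_dvd:
  assumes "n0 \<le> n" and sep: "separated n0 k n c" and c: "c \<in> PiE {1..n} (grid_nodes n0 k b n)"
  shows "anchor_modulus n0 k a n dvd (\<Prod>l=1..n. anchor_factor a b (c l))"
proof -
  obtain \<sigma> where bij: "bij_betw \<sigma> {..<n} {1..n}"
    and window: "\<And>i. i < n \<Longrightarrow>
      int (step_position n0 k i) \<le> c (\<sigma> i) \<and> c (\<sigma> i) \<le> int (step_position n0 k i + b)"
    by (rule separated_grid_windows[OF assms]) blast
  have "anchor_modulus n0 k a n dvd (\<Prod>i<n. anchor_factor a b (c (\<sigma> i)))"
    unfolding anchor_modulus_def
  proof (rule prod_dvd_prod)
    fix i assume "i \<in> {..<n}"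
    then show "linear_factors {int (step_position n0 k i) + 1..int (step_position n0 k i) + int a}
        dvd anchor_factor a b (c (\<sigma> i))"
      using window[of i] unfolding anchor_factor_def linear_factors_def
      by (intro dvd_smult prod_dvd_prod_subset) auto
  qed
  also have "(\<Prod>i<n. anchor_factor a b (c (\<sigma> i))) = (\<Prod>l=1..n. anchor_factor a b (c l))"
    using prod.reindex_bij_betw[OF bij] by simp
  finally show ?thesis .
qed

definition tight_node :: "nat \<Rightarrow> nat \<Rightarrow> nat \<Rightarrow> nat \<Rightarrow> nat \<Rightarrow> int" where
  "tight_node n0 k b n = (\<lambda>l\<in>{1..n}. int (step_position n0 k (l - 1) + b))"

lemma tight_node_in_grid:
  "tight_node n0 k b n \<in> PiE {1..n} (grid_nodes n0 k b n)"
proof -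
  have "int (step_position n0 k (l - 1) + b) \<in> grid_nodes n0 k b n l" if l: "l \<in> {1..n}" for l
  proof -
    have "step_position n0 k (l - 1) \<le> step_position n0 k (n - 1)"
      using l by (intro step_position_mono) auto
    moreover have "step_position n0 k (l - 1) \<le> step_position n0 k i" if "l \<le> n0" "n0 \<le> i" for i
      using that by (intro step_position_mono) auto
    ultimately show ?thesis by (fastforce simp: grid_nodes_def)
  qed
  then show ?thesis by (auto simp: tight_node_def)
qed

text \<open>
  Evaluating at \<open>x\<^sub>0 = 0\<close> excludes the values in \<open>{0..<b}\<close>. So the whole chain is pushed up by \<open>b\<close>, which
  is all the room that the windows leave.
\<close>

lemma nonvanishing_node_tight:
  assumes "n0 \<le> n" and c: "c \<in> PiE {1..n} (grid_nodes n0 k b n)"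
    and nz: "pair_factor n0 k n c * (\<Prod>l=1..n. poly (anchor_factor a b (c l)) 0) \<noteq> 0"
  shows "c = tight_node n0 k b n"
proof -
  have sep: "separated n0 k n c" using nz by (intro pair_factor_separated) auto
  have ge: "int b \<le> c l" if l: "l \<in> {1..n}" for l
  proof (rule ccontr)
    assume "\<not> int b \<le> c l"
    moreover have "0 \<le> c l" using c l by (auto simp: PiE_iff grid_nodes_def)
    ultimately have "poly (anchor_factor a b (c l)) 0 = 0"
      by (auto simp: anchor_factor_def poly_linear_factors prod_zero_iff intro!: bexI[of _ 0])
    with l have "(\<Prod>l=1..n. poly (anchor_factor a b (c l)) 0) = 0"
      by (intro prod_zero) auto
    with nz show False by simp
  qed
  obtain \<sigma> where window: "\<And>i. i < n \<Longrightarrow>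
      int (step_position n0 k i) \<le> c (\<sigma> i) \<and> c (\<sigma> i) \<le> int (step_position n0 k i + b)"
    and "(\<forall>l\<in>{1..n}. int b \<le> c l) \<Longrightarrow>
      (\<forall>i<n. \<sigma> i = Suc i \<and> c (\<sigma> i) = int (step_position n0 k i + b))"
    by (rule separated_grid_windows[OF assms(1) sep c]) blast
  then have tight: "\<forall>i<n. \<sigma> i = Suc i \<and> c (\<sigma> i) = int (step_position n0 k i + b)" using ge by blast
  show ?thesis
  proof (rule PiE_ext[OF c tight_node_in_grid])
    fix l assume l: "l \<in> {1..n}"
    then have "l - 1 < n" by auto
    with tight have "\<sigma> (l - 1) = Suc (l - 1)"
      "c (\<sigma> (l - 1)) = int (step_position n0 k (l - 1) + b)" by blast+
    with l show "c l = tight_node n0 k b n l" by (simp add: tight_node_def)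
  qed
qed

text \<open>
  Divisibility by the modulus turns the functional in \<open>x\<^sub>0\<close> into an evaluation at \<open>0\<close> for every grid
  point, and that evaluation vanishes at all points but one.
\<close>

theorem CT_eq_tight_node_value:
  fixes a b k n n0 :: nat
  assumes "n0 \<le> n"
  defines "u \<equiv> tight_node n0 k b n"
  shows "CT (\<Prod>(i, j)\<in>off_diag 0 n. (1 - lratio i j) ^ forrester_exponent n0 a b k i j)
       = (\<Prod>l=1..n. node_weight (grid_nodes n0 k b n l) (u l)) * pair_factor n0 k n u
         * (\<Prod>l=1..n. poly (anchor_factor a b (u l)) 0) / poly (anchor_modulus n0 k a n) 0"
proof -
  let ?W = "anchor_modulus n0 k a n" and ?C = "grid_nodes n0 k b n"
  let ?m = "forrester_exponent n0 a b k"
  \<comment> \<open>the grid has the size that the degrees of the kernel require\<close>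
  have grid: "finite (?C l) \<and> card (?C l) = Suc (\<Sum>i\<in>{0..n}-{l}. ?m i l)" if l: "l \<in> {1..n}" for l
  proof -
    have "{0..n} - {l} = insert 0 ({1..n} - {l})" using l by auto
    then have "(\<Sum>i\<in>{0..n}-{l}. ?m i l) = b + (\<Sum>i\<in>{1..n}-{l}. min_gap n0 k i l)"
      using l by (simp add: forrester_exponent_def)
    also have "(\<Sum>i\<in>{1..n}-{l}. min_gap n0 k i l)
        = (\<Sum>i\<in>{1..n}-{l}. k + (if n0 < i \<and> n0 < l then 1 else 0))"
      by (rule sum.cong) (auto simp: min_gap_def)
    also have "\<dots> = (n - 1) * k + card {i \<in> {1..n}-{l}. n0 < i \<and> n0 < l}"
      using l by (simp add: sum.distrib sum.If_cases Int_def)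
    also have "card {i \<in> {1..n}-{l}. n0 < i \<and> n0 < l} = (if l \<le> n0 then 0 else n - 1 - n0)"
    proof (cases "l \<le> n0")
      case False
      then have "{i \<in> {1..n}-{l}. n0 < i \<and> n0 < l} = {n0<..n} - {l}" by auto
      with False l show ?thesis by simp
    qed simp
    finally show ?thesis by (simp add: card_grid_nodes)
  qed
  have deg: "degree ?W = (\<Sum>i=1..n. ?m i 0)"
    by (simp add: degree_anchor_modulus forrester_exponent_def)
  let ?w = "\<lambda>c. \<Prod>l=1..n. node_weight (?C l) (c l)"
  let ?v = "\<lambda>c. pair_factor n0 k n c * (\<Prod>l=1..n. poly (anchor_factor a b (c l)) 0)"
  have node_value: "poly (shifted_kernel ?m n (grid_point c) div ?W) 0 = ?v c / poly ?W 0"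
    if c: "c \<in> PiE {1..n} ?C" for c
  proof -
    let ?K = "smult (pair_factor n0 k n c) (\<Prod>l=1..n. anchor_factor a b (c l))"
    have "?W dvd ?K"
    proof (cases "pair_factor n0 k n c = 0")
      case False
      then show ?thesis
        using anchor_modulus_dvd[OF assms(1) pair_factor_separated c] by (intro dvd_smult) auto
    qed simp
    then have "?K = ?K div ?W * ?W" by simp
    then have "poly ?K 0 = poly (?K div ?W) 0 * poly ?W 0" by (metis poly_mult)
    then show ?thesis
      unfolding shifted_kernel_grid_point
      using poly_anchor_modulus_nonzero[of n0 k a n] by (simp add: field_simps poly_prod)
  qed
  have "CT (\<Prod>(i, j)\<in>off_diag 0 n. (1 - lratio i j) ^ ?m i j)
      = grid_functional ?W n ?C (shifted_kernel ?m n)"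
    by (rule CT_eq_grid_functional[OF grid lead_coeff_anchor_modulus deg])
  also have "\<dots> = (\<Sum>c\<in>PiE {1..n} ?C. ?w c * (?v c / poly ?W 0))"
    unfolding grid_functional_def by (rule sum.cong) (simp_all add: node_value)
  also have "\<dots> = (\<Sum>c\<in>{u}. ?w c * (?v c / poly ?W 0))"
  proof (rule sum.mono_neutral_right)
    show "finite (PiE {1..n} ?C)" by (intro finite_PiE) auto
    show "{u} \<subseteq> PiE {1..n} ?C" using tight_node_in_grid by (simp add: u_def)
    show "\<forall>c\<in>PiE {1..n} ?C - {u}. ?w c * (?v c / poly ?W 0) = 0"
      using nonvanishing_node_tight[OF assms(1)] unfolding u_def by fastforce
  qed
  finally show ?thesis by simp
qed

section \<open>Products of factorials\<close>

lemma telescoping_fact_ratio: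
  "(\<Prod>m=1..N. fact ((m + 1) * d) / fact ((m - 1) * d)) = (fact ((N + 1) * d) * fact (N * d) / fact d :: rat)"
proof (induction N)
  case 0
  then show ?case by simp
next
  case (Suc N)
  then show ?case by (simp add: field_simps)
qed

text \<open>
  The contribution of a light index \<open>i\<close>, for a staircase of growing length \<open>N\<close>. The ratios telescope along
  steps of length \<open>k\<close>. Along steps of length \<open>k + 1\<close> consecutive factorials miss each other by one
  factor on either side, and the two extra products supply these factors. The first of them comes from the
  nodes that are removed for light indices.
\<close>

lemma light_label_product:
  fixes k :: nat
  assumes "i < n0" and "i \<le> N"
  defines "D \<equiv> \<lambda>j. step_position n0 k j - step_position n0 k i"
  shows "(\<Prod>j\<in>{i<..N}. fact (D j + k) / fact (D j - k)) * (\<Prod>j\<in>{n0..<N}. of_nat (D j + 1))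
           * (\<Prod>j\<in>{n0<..N}. of_nat (D j))
         = (fact (D N + k) * fact (D N) / fact k :: rat)"
  using assms(2)
proof (induction N rule: dec_induct)
  case base
  then show ?case using assms(1) by (simp add: D_def)
next
  case (step N)
  have ins: "{i<..Suc N} = insert (Suc N) {i<..N}" using step.hyps by auto
  have ge: "step_position n0 k i \<le> step_position n0 k N"
    using step.hyps by (intro step_position_mono) auto
  show ?case
  proof (cases "n0 \<le> N")
    case True
    have D_Suc: "D (Suc N) = D N + k + 1" using ge True by (simp add: D_def step_position_Suc)
    have ins': "{n0..<Suc N} = insert N {n0..<N}" "{n0<..Suc N} = insert (Suc N) {n0<..N}"
      using True by auto
    let ?P = "\<Prod>j\<in>{i<..N}. fact (D j + k) / fact (D j - k) :: rat"
    let ?Q = "\<Prod>j\<in>{n0..<N}. of_nat (D j + 1) :: rat"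
    let ?R = "\<Prod>j\<in>{n0<..N}. of_nat (D j) :: rat"
    have "fact (D (Suc N) + k) / fact (D (Suc N) - k) * ?P * (of_nat (D N + 1) * ?Q)
        * (of_nat (D (Suc N)) * ?R)
      = fact (D (Suc N) + k) / fact (D N + 1) * of_nat (D N + 1) * of_nat (D (Suc N)) * (?P * ?Q * ?R)"
      by (simp add: D_Suc)
    also have "\<dots> = fact (D (Suc N) + k) / fact (D N + 1) * of_nat (D N + 1) * of_nat (D (Suc N))
        * (fact (D N + k) * fact (D N) / fact k)"
      unfolding step.IH ..
    also have "\<dots> = fact (D (Suc N) + k) * (of_nat (D N + k + 1) * fact (D N + k)) / fact k"
    proof -
      have cancel: "x / (w * y) * w * v * (z * y / w') = x * (v * z) / w'"
        if "w \<noteq> 0" "y \<noteq> 0" for x y z v w w' :: rat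
        using that by simp
      have "(fact (D N + 1) :: rat) = of_nat (D N + 1) * fact (D N)" by (metis Suc_eq_plus1 fact_Suc)
      moreover have "of_nat (D N + 1) \<noteq> (0 :: rat)" by (simp only: of_nat_eq_0_iff)
      ultimately show ?thesis using cancel[OF _ fact_nonzero] by (simp only: D_Suc)
    qed
    also have "of_nat (D N + k + 1) * fact (D N + k) = (fact (D (Suc N)) :: rat)"
      unfolding D_Suc by (metis Suc_eq_plus1 fact_Suc)
    finally show ?thesis unfolding ins ins' by simp
  next
    case False
    have D_Suc: "D (Suc N) = D N + k" using ge False by (simp add: D_def step_position_Suc)
    have emp: "{n0..<Suc N} = {}" "{n0<..Suc N} = {}" "{n0..<N} = {}" "{n0<..N} = {}"
      using False by auto
    have "fact (D (Suc N) + k) / fact (D (Suc N) - k) * (\<Prod>j\<in>{i<..N}. fact (D j + k) / fact (D j - k))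
        = fact (D (Suc N) + k) / fact (D N) * (fact (D N + k) * fact (D N) / fact k :: rat)"
      using step.IH unfolding emp by (simp add: D_Suc)
    also have "\<dots> = fact (D (Suc N) + k) * fact (D (Suc N)) / fact k" by (simp add: D_Suc)
    finally show ?thesis unfolding ins emp by simp
  qed
qed

text \<open>
  Induction on the number of heavy indices. The differences between light and heavy positions complete
  the factorials in the last product to those of a staircase that is longer by one.
\<close>

lemma staircase_fact_product:
  "(\<Prod>r<N. \<Prod>q=1..m. (q + r + 1) * k + q) * (\<Prod>r<N. fact ((r + 1) * k)) * (\<Prod>q\<le>m. fact ((N + q + 1) * k + q))
   = (\<Prod>q\<le>m. fact ((q + 1) * k + q)) * (\<Prod>r<N. fact ((m + 2 + r) * k + m) :: nat)"
proof (induction m)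
  case 0
  define g :: "nat \<Rightarrow> nat" where "g r = fact ((r + 1) * k)" for r
  have "(\<Prod>r<N. g r) * g N = g 0 * (\<Prod>r<N. g (Suc r))"
    by (simp only: prod.lessThan_Suc[symmetric] prod.lessThan_Suc_shift)
  then show ?case by (simp add: g_def)
next
  case (Suc m)
  define g :: "nat \<Rightarrow> nat" where "g r = fact ((Suc m + 1 + r) * k + Suc m)" for r
  have g: "((Suc m + r + 1) * k + Suc m) * fact ((m + 2 + r) * k + m) = g r" for r
    by (simp add: g_def algebra_simps)
  let ?A = "\<Prod>r<N. \<Prod>q=1..m. (q + r + 1) * k + q" and ?B = "\<Prod>r<N. fact ((r + 1) * k) :: nat"
    and ?C = "\<Prod>q\<le>m. fact ((N + q + 1) * k + q) :: nat" and ?E = "\<Prod>q\<le>m. fact ((q + 1) * k + q) :: nat"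
  have "(\<Prod>r<N. \<Prod>q=1..Suc m. (q + r + 1) * k + q) = ?A * (\<Prod>r<N. (Suc m + r + 1) * k + Suc m)"
  proof -
    have "(\<Prod>q=1..Suc m. (q + r + 1) * k + q)
        = (\<Prod>q=1..m. (q + r + 1) * k + q) * ((Suc m + r + 1) * k + Suc m)" for r
      by (simp only: prod.cl_ivl_Suc) simp
    then show ?thesis by (simp only: prod.distrib)
  qed
  moreover have "(\<Prod>q\<le>Suc m. fact ((N + q + 1) * k + q)) = ?C * g N"
    by (simp add: g_def algebra_simps)
  moreover have "(\<Prod>q\<le>Suc m. fact ((q + 1) * k + q)) = ?E * g 0"
    by (simp add: g_def algebra_simps)
  moreover have "(\<Prod>r<N. fact ((Suc m + 2 + r) * k + Suc m)) = (\<Prod>r<N. g (Suc r))"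
    by (simp add: g_def algebra_simps)
  moreover have "?A * (\<Prod>r<N. (Suc m + r + 1) * k + Suc m) * ?B * (?C * g N)
      = ?E * g 0 * (\<Prod>r<N. g (Suc r))"
  proof -
    have "?A * (\<Prod>r<N. (Suc m + r + 1) * k + Suc m) * ?B * (?C * g N)
        = (?A * ?B * ?C) * (\<Prod>r<N. (Suc m + r + 1) * k + Suc m) * g N"
      by (simp only: mult_ac)
    also have "\<dots> = ?E * (\<Prod>r<N. ((Suc m + r + 1) * k + Suc m) * fact ((m + 2 + r) * k + m)) * g N"
      unfolding Suc.IH prod.distrib by (simp only: mult_ac)
    also have "\<dots> = ?E * ((\<Prod>r<N. g r) * g N)" unfolding g by (simp only: mult_ac)
    also have "(\<Prod>r<N. g r) * g N = g 0 * (\<Prod>r<N. g (Suc r))"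
      by (simp only: prod.lessThan_Suc[symmetric] prod.lessThan_Suc_shift)
    finally show ?thesis by (simp only: mult_ac)
  qed
  ultimately show ?case by (simp only:)
qed

section \<open>The value at the surviving grid point\<close>

lemma prod_consecutive_fact:
  "(\<Prod>r\<in>{int N + 1..int N + int b}. of_int r) = (fact (N + b) / fact N :: rat)"
proof (induction b)
  case 0
  then show ?case by simp
next
  case (Suc b)
  have "{int N + 1..int N + int (Suc b)} = insert (int N + int b + 1) {int N + 1..int N + int b}"
    by auto
  then have "(\<Prod>r\<in>{int N + 1..int N + int (Suc b)}. of_int r)
      = of_int (int N + int b + 1) * (fact (N + b) / fact N :: rat)"
    using Suc by simp
  also have "of_int (int N + int b + 1) = (of_nat (Suc (N + b)) :: rat)" by simp
  finally show ?case by (simp add: add.commute)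
qed

lemma anchor_ratio:
  "poly (anchor_factor a b (int (s + b))) 0 / poly (linear_factors {int s + 1..int s + int a}) 0
     = fact (s + a + b) / fact (s + a)"
proof -
  have split: "{int (s + b) - int b + 1..int (s + b) + int a}
      = {int s + 1..int s + int a} \<union> {int (s + a) + 1..int (s + a) + int b}" by auto
  have neg: "(\<Prod>r\<in>{int (s + a) + 1..int (s + a) + int b}. - of_int r :: rat)
      = (-1) ^ b * (fact (s + a + b) / fact (s + a))"
    unfolding prod_consecutive_fact [symmetric] by (simp add: prod_uminus)
  have "poly (anchor_factor a b (int (s + b))) 0
      = (-1) ^ b * (poly (linear_factors {int s + 1..int s + int a}) 0
          * (\<Prod>r\<in>{int (s + a) + 1..int (s + a) + int b}. - of_int r))"
    unfolding anchor_factor_def split poly_smult poly_linear_factors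
    by (subst prod.union_disjoint) auto
  moreover have "poly (linear_factors {int s + 1..int s + int a}) 0 \<noteq> 0"
    by (auto simp: poly_linear_factors prod_zero_iff)
  moreover have "(-1) ^ b * ((-1) ^ b :: rat) = 1"
    by (simp add: power_mult_distrib [symmetric])
  ultimately show ?thesis unfolding neg by (simp add: mult.left_commute)
qed

lemma prod_interval_differences:
  assumes "v \<le> B"
  shows "(\<Prod>c\<in>{0..int B} - {int v}. of_int (int v - c)) = ((-1) ^ (B - v) * fact v * fact (B - v) :: rat)"
proof -
  have split: "{0..int B} - {int v} = {0..<int v} \<union> {int v<..int B}" using assms by auto
  have low: "(\<Prod>c\<in>{0..<int v}. of_int (int v - c)) = (fact v :: rat)"
  proof -
    have "(\<Prod>c\<in>{0..<int v}. of_int (int v - c) :: rat) = (\<Prod>r\<in>{int 0 + 1..int 0 + int v}. of_int r)"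
      by (rule prod.reindex_bij_witness[where i = "\<lambda>r. int v - r" and j = "\<lambda>c. int v - c"]) auto
    then show ?thesis unfolding prod_consecutive_fact by simp
  qed
  have high: "(\<Prod>c\<in>{int v<..int B}. of_int (int v - c)) = ((-1) ^ (B - v) * fact (B - v) :: rat)"
  proof -
    have "(\<Prod>c\<in>{int v<..int B}. of_int (int v - c) :: rat)
        = (\<Prod>r\<in>{int 0 + 1..int 0 + int (B - v)}. - of_int r)"
      by (rule prod.reindex_bij_witness[where i = "\<lambda>r. int v + r" and j = "\<lambda>c. c - int v"])
        (use assms in auto)
    also have "\<dots> = (-1) ^ (B - v) * (\<Prod>r\<in>{int 0 + 1..int 0 + int (B - v)}. of_int r)"
      by (simp add: prod_uminus)
    finally show ?thesis unfolding prod_consecutive_fact by simp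
  qed
  show ?thesis
    unfolding split by (subst prod.union_disjoint) (auto simp: low [simplified] high [simplified])
qed

text \<open>
  Removing nodes from an interval divides out their differences from the product of all differences,
  which therefore reappear in the numerator.
\<close>

lemma node_weight_punctured_interval:
  assumes "v \<le> B" and E: "E \<subseteq> {0..int B}" "int v \<notin> E"
  shows "node_weight ({0..int B} - E) (int v)
     = (\<Prod>e\<in>E. of_int (int v - e)) / ((-1) ^ (B - v) * fact v * fact (B - v))"
proof -
  have fin: "finite E" using E(1) by (rule finite_subset) simp
  have split: "{0..int B} - {int v} = ({0..int B} - E - {int v}) \<union> E" using E by auto
  have "(\<Prod>c\<in>{0..int B} - {int v}. of_int (int v - c) :: rat)
      = (\<Prod>c\<in>{0..int B} - E - {int v}. of_int (int v - c)) * (\<Prod>e\<in>E. of_int (int v - e))"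
    unfolding split using fin by (intro prod.union_disjoint) auto
  then have "(\<Prod>c\<in>{0..int B} - E - {int v}. of_int (int v - c)) * (\<Prod>e\<in>E. of_int (int v - e))
      = ((-1) ^ (B - v) * fact v * fact (B - v) :: rat)"
    unfolding prod_interval_differences[OF assms(1)] by simp
  moreover have "(\<Prod>e\<in>E. of_int (int v - e) :: rat) \<noteq> 0"
    using fin E(2) by (auto simp: prod_zero_iff simp del: of_int_diff)
  ultimately have "(\<Prod>c\<in>{0..int B} - E - {int v}. of_int (int v - c))
      = ((-1) ^ (B - v) * fact v * fact (B - v)) / (\<Prod>e\<in>E. of_int (int v - e) :: rat)"
    by (metis nonzero_eq_divide_eq)
  then show ?thesis unfolding node_weight_def by (simp only: divide_divide_eq_right mult_1)
qed

lemma node_weight_tight: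
  fixes n0 k n b :: nat
  assumes "i < n"
  defines "s \<equiv> step_position n0 k"
  shows "node_weight (grid_nodes n0 k b n (Suc i)) (int (s i + b))
     = (if i < n0 then (\<Prod>j\<in>{n0..<n - 1}. - of_nat (s j - s i + 1)) else 1)
       / ((-1) ^ (s (n - 1) - s i) * fact (s i + b) * fact (s (n - 1) - s i))"
proof -
  have le: "s i + b \<le> s (n - 1) + b"
    unfolding s_def using assms(1) by (auto intro: step_position_mono)
  show ?thesis
  proof (cases "i < n0")
    case True
    let ?E = "(\<lambda>j. int (s j + b + 1)) ` {n0..<n - 1}"
    have sub: "?E \<subseteq> {0..int (s (n - 1) + b)}"
    proof
      fix x assume "x \<in> ?E"
      then obtain j where j: "n0 \<le> j" "j < n - 1" and x: "x = int (s j + b + 1)" by auto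
      show "x \<in> {0..int (s (n - 1) + b)}"
        using excluded_nodes_bounded[OF j, of k b] unfolding x s_def by simp
    qed
    have ge: "s i \<le> s j" if "n0 \<le> j" for j
      unfolding s_def using that True by (intro step_position_mono) simp
    then have notin: "int (s i + b) \<notin> ?E" by force
    have "(\<Prod>e\<in>?E. of_int (int (s i + b) - e)) = (\<Prod>j\<in>{n0..<n - 1}. - of_nat (s j - s i + 1) :: rat)"
    proof -
      have "inj_on (\<lambda>j. int (s j + b + 1)) {n0..<n - 1}"
        using inj_on_step_position[of n0 k "b + 1" "n - 1"] by (simp add: s_def add.assoc)
      then have "(\<Prod>e\<in>?E. of_int (int (s i + b) - e) :: rat)
          = (\<Prod>j\<in>{n0..<n - 1}. of_int (int (s i + b) - int (s j + b + 1)))"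
        by (simp only: prod.reindex comp_def)
      also have "\<dots> = (\<Prod>j\<in>{n0..<n - 1}. - of_nat (s j - s i + 1))"
        by (rule prod.cong) (use ge in \<open>auto simp: of_nat_diff\<close>)
      finally show ?thesis .
    qed
    with node_weight_punctured_interval[OF le sub notin] True show ?thesis
      by (simp add: grid_nodes_def s_def)
  next
    case False
    with node_weight_punctured_interval[OF le, of "{}"] show ?thesis
      by (simp add: grid_nodes_def s_def)
  qed
qed

lemma prod_off_diag_pairs:
  fixes f :: "nat \<times> nat \<Rightarrow> 'a::comm_monoid_mult"
  shows "(\<Prod>p\<in>off_diag 1 n. f p) = (\<Prod>i<n. \<Prod>j\<in>{i<..<n}. f (Suc i, Suc j) * f (Suc j, Suc i))"
proof -
  let ?S = "SIGMA i:{..<n}. {i<..<n}"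
  let ?g = "\<lambda>(i, j). (Suc i, Suc j)" and ?h = "\<lambda>(i, j). (Suc j, Suc i)"
  have split: "off_diag 1 n = ?g ` ?S \<union> ?h ` ?S"
  proof
    show "off_diag 1 n \<subseteq> ?g ` ?S \<union> ?h ` ?S"
    proof
      fix p assume "p \<in> off_diag 1 n"
      then obtain i j where p: "p = (Suc i, Suc j)" "i < n" "j < n" "i \<noteq> j"
        by (cases p) (auto simp: off_diag_def Suc_le_eq gr0_conv_Suc)
      then consider "i < j" | "j < i" by linarith
      then show "p \<in> ?g ` ?S \<union> ?h ` ?S"
      proof cases
        case 1
        with p have "(i, j) \<in> ?S" by auto
        with p(1) show ?thesis by force
      next
        case 2
        with p have "(j, i) \<in> ?S" by auto
        with p(1) show ?thesis by force
      qed
    qed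
  qed (auto simp: off_diag_def)
  have inj: "inj_on ?g ?S" "inj_on ?h ?S" by (auto simp: inj_on_def)
  have "(\<Prod>p\<in>off_diag 1 n. f p) = (\<Prod>p\<in>?g ` ?S. f p) * (\<Prod>p\<in>?h ` ?S. f p)"
    unfolding split by (rule prod.union_disjoint) auto
  also have "\<dots> = (\<Prod>q\<in>?S. f (?g q)) * (\<Prod>q\<in>?S. f (?h q))"
    using inj by (simp only: prod.reindex comp_def)
  also have "\<dots> = (\<Prod>(i, j)\<in>?S. f (Suc i, Suc j) * f (Suc j, Suc i))"
    by (simp add: prod.distrib [symmetric] case_prod_beta)
  also have "\<dots> = (\<Prod>i<n. \<Prod>j\<in>{i<..<n}. f (Suc i, Suc j) * f (Suc j, Suc i))"
    by (simp add: prod.Sigma)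
  finally show ?thesis .
qed

lemma prod_shifted_differences:
  assumes "e \<le> D" and "i < j"
  shows "(\<Prod>t\<in>shifts i j e. of_int (int D - t)) * (\<Prod>t\<in>shifts j i e. of_int (- int D - t))
     = ((-1) ^ e * (fact (D + e) / fact (D - e)) :: rat)"
proof -
  have "(\<Prod>t\<in>shifts i j e. of_int (int D - t) :: rat)
      = (\<Prod>r\<in>{int (D - e) + 1..int (D - e) + int e}. of_int r)"
    by (rule prod.reindex_bij_witness[where i = "\<lambda>r. int D - r" and j = "\<lambda>t. int D - t"])
      (use assms in \<open>auto simp: shifts_def of_nat_diff\<close>)
  also have "\<dots> = fact D / fact (D - e)"
    unfolding prod_consecutive_fact using assms(1) by simp
  finally have 1: "(\<Prod>t\<in>shifts i j e. of_int (int D - t) :: rat) = fact D / fact (D - e)" .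
  have "(\<Prod>t\<in>shifts j i e. of_int (- int D - t) :: rat)
      = (\<Prod>r\<in>{int D + 1..int D + int e}. - of_int r)"
    by (rule prod.reindex_bij_witness[where i = "\<lambda>r. r - int D" and j = "\<lambda>t. int D + t"])
      (use assms in \<open>auto simp: shifts_def\<close>)
  also have "\<dots> = (-1) ^ e * (fact (D + e) / fact D)"
    unfolding prod_consecutive_fact [symmetric] by (simp add: prod_uminus)
  finally show ?thesis unfolding 1 by simp
qed

lemma pair_factor_tight:
  fixes n0 k n b :: nat
  defines "s \<equiv> step_position n0 k"
  shows "pair_factor n0 k n (tight_node n0 k b n)
     = (\<Prod>i<n. \<Prod>j\<in>{i<..<n}. let e = (if n0 \<le> i then k + 1 else k) in
          (-1) ^ e * (fact (s j - s i + e) / fact (s j - s i - e)))"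
  unfolding pair_factor_def case_prod_beta prod_off_diag_pairs
proof (intro prod.cong refl)
  fix i j assume "i \<in> {..<n}" "j \<in> {i<..<n}"
  then have ij: "i < j" "j < n" by auto
  let ?e = "if n0 \<le> i then k + 1 else k"
  have gap: "min_gap n0 k (Suc i) (Suc j) = ?e" "min_gap n0 k (Suc j) (Suc i) = ?e"
    using ij by (auto simp: min_gap_def)
  have "s (Suc i) \<le> s j" unfolding s_def using ij by (intro step_position_mono) simp
  then have ge: "s i + ?e \<le> s j" by (simp add: s_def step_position_Suc split: if_splits)
  have u: "tight_node n0 k b n (Suc i) = int (s i + b)" "tight_node n0 k b n (Suc j) = int (s j + b)"
    using ij by (simp_all add: tight_node_def s_def)
  have diff: "int (s j + b) - int (s i + b) = int (s j - s i)"
    "int (s i + b) - int (s j + b) = - int (s j - s i)"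
    using ge by (simp_all add: of_nat_diff)
  have "(\<Prod>t\<in>shifts (Suc i) (Suc j) ?e. of_int (int (s j - s i) - t))
      * (\<Prod>t\<in>shifts (Suc j) (Suc i) ?e. of_int (- int (s j - s i) - t))
      = ((-1) ^ ?e * (fact (s j - s i + ?e) / fact (s j - s i - ?e)) :: rat)"
    by (rule prod_shifted_differences) (use ge ij in simp_all)
  then show "(\<Prod>t\<in>shifts (fst (Suc i, Suc j)) (snd (Suc i, Suc j))
          (min_gap n0 k (fst (Suc i, Suc j)) (snd (Suc i, Suc j))).
        of_int (tight_node n0 k b n (snd (Suc i, Suc j)) - tight_node n0 k b n (fst (Suc i, Suc j)) - t))
      * (\<Prod>t\<in>shifts (fst (Suc j, Suc i)) (snd (Suc j, Suc i))
          (min_gap n0 k (fst (Suc j, Suc i)) (snd (Suc j, Suc i))).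
        of_int (tight_node n0 k b n (snd (Suc j, Suc i)) - tight_node n0 k b n (fst (Suc j, Suc i)) - t))
      = (let e = ?e in (-1) ^ e * (fact (s j - s i + e) / fact (s j - s i - e)) :: rat)"
    by (simp only: fst_conv snd_conv gap u diff Let_def)
qed

text \<open>
  The part of the final value that belongs to position \<open>i\<close> and involves neither \<open>a\<close> nor \<open>b\<close>.
\<close>

definition label_factor :: "nat \<Rightarrow> nat \<Rightarrow> nat \<Rightarrow> nat \<Rightarrow> rat" where
  "label_factor n0 k n i =
     (if i < n0
      then fact (step_position n0 k (n - 1) - step_position n0 k i + k) / fact k
             / (\<Prod>j\<in>{n0<..<n}. of_nat (step_position n0 k j - step_position n0 k i))
      else fact ((n - i) * (k + 1)) / fact (k + 1))"

text \<open>
  The weight of position \<open>i\<close> is combined with the pairs formed with the higher positions only. The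
  signs cancel within each position, because the exponents of these pairs, together with the number
  of removed nodes if \<open>i\<close> is light, add up to the distance from position \<open>i\<close> to the top.
\<close>

lemma label_factor_eq:
  fixes n0 k n b :: nat
  assumes "i < n" and "n0 \<le> n"
  defines "s \<equiv> step_position n0 k"
  shows "node_weight (grid_nodes n0 k b n (Suc i)) (int (s i + b))
       * (\<Prod>j\<in>{i<..<n}. let e = (if n0 \<le> i then k + 1 else k) in
            (-1) ^ e * (fact (s j - s i + e) / fact (s j - s i - e)))
     = label_factor n0 k n i / fact (s i + b)"
proof -
  have weight: "node_weight (grid_nodes n0 k b n (Suc i)) (int (s i + b))
     = (if i < n0 then (\<Prod>j\<in>{n0..<n - 1}. - of_nat (s j - s i + 1)) else 1)
       / ((-1) ^ (s (n - 1) - s i) * fact (s i + b) * fact (s (n - 1) - s i))"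
    using node_weight_tight[OF assms(1)] by (simp only: s_def)
  show ?thesis
  proof (cases "i < n0")
    case True
    let ?D = "\<lambda>j. s j - s i"
    let ?P = "\<Prod>j\<in>{i<..<n}. fact (?D j + k) / fact (?D j - k) :: rat"
    let ?Q = "\<Prod>j\<in>{n0..<n - 1}. of_nat (?D j + 1) :: rat"
    let ?R = "\<Prod>j\<in>{n0<..<n}. of_nat (?D j) :: rat"
    have sets: "{i<..n - 1} = {i<..<n}" "{n0<..n - 1} = {n0<..<n}" using assms(1) by auto
    have eval: "?P * ?Q * ?R = fact (?D (n - 1) + k) * fact (?D (n - 1)) / fact k"
      using light_label_product[OF True, of "n - 1" k] assms(1) unfolding sets s_def by simp
    have pos: "0 < ?D j" if "n0 < j" for j
      using step_position_less[of n0 n0 j k] step_position_mono[of i n0 n0 k] that True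
      unfolding s_def by simp
    have R: "?R \<noteq> 0"
    proof -
      have "of_nat (?D j) \<noteq> (0 :: rat)" if "j \<in> {n0<..<n}" for j
        using pos[of j] that by simp
      then show ?thesis by (simp add: prod_zero_iff)
    qed
    have sign: "(-1) ^ (n - 1 - n0) * ((-1) ^ k) ^ (n - 1 - i) = ((-1) ^ ?D (n - 1) :: rat)"
    proof -
      have "s i = i * k" using True by (simp add: s_def step_position_def)
      moreover have "n - 1 = i + (n - 1 - i)" using assms(1) by simp
      ultimately have "?D (n - 1) = (n - 1 - n0) + k * (n - 1 - i)"
        unfolding s_def step_position_def by (simp add: algebra_simps diff_mult_distrib2)
      then show ?thesis by (simp add: power_add power_mult)
    qed
    have cancel: "x * q / (sg * f * g) * (y * p) = h / l / r / f"
      if "x * y = sg" "p * q * r = h * g / l" "sg \<noteq> 0" "f \<noteq> 0" "g \<noteq> 0" "l \<noteq> 0" "r \<noteq> 0"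
      for x y sg p q r h g l f :: rat
    proof -
      have "x * q / (sg * f * g) * (y * p) = (x * y) * (p * q * r) / (sg * f * g * r)"
        using that(7) by (simp add: field_simps)
      also have "\<dots> = h / l / r / f" unfolding that(1,2) using that by (simp add: field_simps)
      finally show ?thesis .
    qed
    have card: "card {i<..<n} = n - 1 - i" by simp
    have "(if i < n0 then (\<Prod>j\<in>{n0..<n - 1}. - of_nat (s j - s i + 1)) else 1)
        = (-1) ^ (n - 1 - n0) * ?Q"
      using True by (simp only: if_True prod_uminus card_atLeastLessThan)
    moreover have "(\<Prod>j\<in>{i<..<n}. let e = (if n0 \<le> i then k + 1 else k) in
              (-1) ^ e * (fact (?D j + e) / fact (?D j - e)))
        = ((-1) ^ k) ^ (n - 1 - i) * ?P"
      using True by (simp only: Let_def not_le[symmetric] if_False prod.distrib prod_constant card)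
    moreover have "label_factor n0 k n i = fact (?D (n - 1) + k) / fact k / ?R"
      using True by (simp add: label_factor_def s_def)
    moreover have "(-1) ^ (n - 1 - n0) * ?Q / ((-1) ^ ?D (n - 1) * fact (s i + b) * fact (?D (n - 1)))
        * (((-1) ^ k) ^ (n - 1 - i) * ?P) = fact (?D (n - 1) + k) / fact k / ?R / fact (s i + b)"
    proof (rule cancel[OF sign eval _ fact_nonzero fact_nonzero fact_nonzero R])
      show "(-1) ^ ?D (n - 1) \<noteq> (0 :: rat)" by simp
    qed
    ultimately show ?thesis unfolding weight by (simp only:)
  next
    case False
    let ?D = "\<lambda>j. s j - s i" and ?N = "n - 1 - i"
    have D: "?D (i + m) = m * (k + 1)" for m
      using False by (simp add: s_def step_position_def algebra_simps)
    have last: "?D (n - 1) = ?N * (k + 1)" using D[of ?N] assms(1) by simp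
    have "(\<Prod>j\<in>{i<..<n}. fact (?D j + (k + 1)) / fact (?D j - (k + 1)) :: rat)
        = (\<Prod>m=1..?N. fact ((m + 1) * (k + 1)) / fact ((m - 1) * (k + 1)))"
    proof (rule prod.reindex_bij_witness[where i = "\<lambda>m. i + m" and j = "\<lambda>j. j - i"])
      fix j assume "j \<in> {i<..<n}"
      then have "?D j = (j - i) * (k + 1)" using D[of "j - i"] by simp
      moreover have "(j - i) * (k + 1) + (k + 1) = (j - i + 1) * (k + 1)"
        "(j - i) * (k + 1) - (k + 1) = (j - i - 1) * (k + 1)" by (simp_all only: add_mult_distrib diff_mult_distrib mult_1)
      ultimately show "fact ((j - i + 1) * (k + 1)) / fact ((j - i - 1) * (k + 1))
          = (fact (?D j + (k + 1)) / fact (?D j - (k + 1)) :: rat)" by (simp only:)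
    qed auto
    also have "\<dots> = fact ((?N + 1) * (k + 1)) * fact (?N * (k + 1)) / fact (k + 1)"
      by (rule telescoping_fact_ratio)
    finally have P: "(\<Prod>j\<in>{i<..<n}. fact (?D j + (k + 1)) / fact (?D j - (k + 1)) :: rat)
        = fact ((n - i) * (k + 1)) * fact (?N * (k + 1)) / fact (k + 1)"
      using assms(1) by (simp add: Suc_diff_Suc)
    have card: "card {i<..<n} = ?N" by simp
    have "(\<Prod>j\<in>{i<..<n}. let e = (if n0 \<le> i then k + 1 else k) in
              (-1) ^ e * (fact (?D j + e) / fact (?D j - e)))
        = ((-1) ^ (k + 1)) ^ ?N * (fact ((n - i) * (k + 1)) * fact (?N * (k + 1)) / fact (k + 1) :: rat)"
      using False by (simp only: Let_def not_less if_True prod.distrib prod_constant card P)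
    also have "((-1) ^ (k + 1)) ^ ?N = ((-1) ^ (?N * (k + 1)) :: rat)"
      by (simp only: power_mult [symmetric] mult.commute)
    finally show ?thesis
      unfolding weight last using False by (simp add: label_factor_def)
  qed
qed

lemma CT_eq_label_factors:
  fixes a b k n n0 :: nat
  assumes "n0 \<le> n"
  defines "s \<equiv> step_position n0 k"
  shows "CT (\<Prod>(i, j)\<in>off_diag 0 n. (1 - lratio i j) ^ forrester_exponent n0 a b k i j)
       = (\<Prod>i<n. fact (s i + a + b) / (fact (s i + a) * fact (s i + b)) * label_factor n0 k n i)"
proof -
  have shift: "(\<Prod>l=1..n. f l) = (\<Prod>i<n. f (Suc i))" for f :: "nat \<Rightarrow> rat"
    by (rule prod.reindex_bij_witness[where i = Suc and j = "\<lambda>l. l - 1"]) auto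
  have u: "tight_node n0 k b n (Suc i) = int (s i + b)" if "i < n" for i
    using that by (simp add: tight_node_def s_def)
  let ?p = "\<lambda>i. \<Prod>j\<in>{i<..<n}. let e = (if n0 \<le> i then k + 1 else k) in
          (-1) ^ e * (fact (s j - s i + e) / fact (s j - s i - e)) :: rat"
  let ?w = "\<lambda>i. node_weight (grid_nodes n0 k b n (Suc i)) (int (s i + b))"
  let ?r = "\<lambda>i. poly (anchor_factor a b (int (s i + b))) 0
        / poly (linear_factors {int (s i) + 1..int (s i) + int a}) 0"
  have "CT (\<Prod>(i, j)\<in>off_diag 0 n. (1 - lratio i j) ^ forrester_exponent n0 a b k i j)
      = (\<Prod>i<n. ?w i) * (\<Prod>i<n. ?p i) * (\<Prod>i<n. ?r i)"
  proof -
    have "(\<Prod>i<n. node_weight (grid_nodes n0 k b n (Suc i)) (tight_node n0 k b n (Suc i)))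
        = (\<Prod>i<n. ?w i)"
      by (rule prod.cong) (simp_all add: u)
    moreover have "(\<Prod>i<n. poly (anchor_factor a b (tight_node n0 k b n (Suc i))) 0)
        = (\<Prod>i<n. poly (anchor_factor a b (int (s i + b))) 0)"
      by (rule prod.cong) (simp_all add: u)
    ultimately show ?thesis
      unfolding CT_eq_tight_node_value[OF assms(1)] pair_factor_tight shift s_def[symmetric]
      by (simp add: anchor_modulus_def poly_prod prod_dividef s_def)
  qed
  also have "\<dots> = (\<Prod>i<n. (?w i * ?p i) * ?r i)" by (simp only: prod.distrib)
  also have "\<dots> = (\<Prod>i<n. fact (s i + a + b) / (fact (s i + a) * fact (s i + b)) * label_factor n0 k n i)"
  proof (rule prod.cong)
    fix i assume "i \<in> {..<n}"
    then have "?w i * ?p i = label_factor n0 k n i / fact (s i + b)"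
      using label_factor_eq[of i n n0 k b] assms(1) by (simp add: s_def)
    then have "(?w i * ?p i) * ?r i
        = label_factor n0 k n i / fact (s i + b) * (fact (s i + a + b) / fact (s i + a))"
      by (simp only: anchor_ratio)
    then show "(?w i * ?p i) * ?r i
        = fact (s i + a + b) / (fact (s i + a) * fact (s i + b)) * label_factor n0 k n i"
      by (simp add: mult_ac)
  qed simp
  finally show ?thesis .
qed

section \<open>Forrester's constant term identity\<close>

lemma prod_lessThan_add:
  fixes f :: "nat \<Rightarrow> 'a::comm_monoid_mult"
  shows "(\<Prod>i<m + n. f i) = (\<Prod>i<m. f i) * (\<Prod>j<n. f (m + j))"
  by (induction n) (simp_all add: mult.assoc)

text \<open>
  The factorials of the heavy positions are those of the claim up to the shift of their
  arguments by \<open>k * n0\<close>. The light positions account for this shift through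
  \<open>staircase_fact_product\<close>.
\<close>

lemma prod_label_factors:
  "(\<Prod>i<n0 + n1. label_factor n0 k (n0 + n1) i)
     = (\<Prod>l<n0. fact (k * (l + 1)) / fact k)
       * (\<Prod>j<n1. of_nat (j + 1) * fact (k * j + k + j + k * n0) / fact k)"
proof (cases n1)
  case 0
  have "(\<Prod>i<n0. label_factor n0 k n0 i) = (\<Prod>i<n0. fact (k * (n0 - Suc i + 1)) / fact k)"
  proof (rule prod.cong)
    fix i assume "i \<in> {..<n0}"
    then have i: "i < n0" by simp
    then have "n0 - 1 = i + (n0 - Suc i)" by simp
    then have "(n0 - 1) * k - i * k + k = k * (n0 - Suc i + 1)"
      by (metis add.commute add_diff_cancel_left' distrib_right mult.commute mult.right_neutral distrib_left)
    moreover have "{n0<..<n0} = {}" by simp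
    ultimately show "label_factor n0 k n0 i = fact (k * (n0 - Suc i + 1)) / fact k"
      using i by (simp add: label_factor_def step_position_def add.commute)
  qed simp
  also have "\<dots> = (\<Prod>l<n0. fact (k * (l + 1)) / fact k)"
    by (rule prod.nat_diff_reindex)
  finally show ?thesis using 0 by simp
next
  case (Suc m)
  let ?n = "n0 + n1"
  have light: "(\<Prod>i<n0. label_factor n0 k ?n i)
      = (\<Prod>r<n0. fact ((m + 2 + r) * k + m)) / fact k ^ n0
        / (\<Prod>r<n0. \<Prod>q=1..m. of_nat ((q + r + 1) * k + q))"
  proof -
    have "(\<Prod>i<n0. label_factor n0 k ?n i)
        = (\<Prod>i<n0. fact ((m + 2 + (n0 - Suc i)) * k + m) / fact k
            / (\<Prod>q=1..m. of_nat ((q + (n0 - Suc i) + 1) * k + q)))"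
    proof (rule prod.cong)
      fix i assume "i \<in> {..<n0}"
      then have i: "i < n0" by simp
      define r where "r = n0 - Suc i"
      have n0: "n0 = i + r + 1" using i by (simp add: r_def)
      have pos: "step_position n0 k (n0 + q) - step_position n0 k i = (q + r + 1) * k + q" for q
        by (simp add: step_position_def n0 algebra_simps)
      have top: "step_position n0 k (?n - 1) - step_position n0 k i + k = (m + 2 + r) * k + m"
        using pos[of m] Suc by (simp add: algebra_simps)
      have "(\<Prod>j\<in>{n0<..<?n}. of_nat (step_position n0 k j - step_position n0 k i) :: rat)
          = (\<Prod>q=1..m. of_nat ((q + r + 1) * k + q))"
      proof (rule prod.reindex_bij_witness[where i = "\<lambda>q. n0 + q" and j = "\<lambda>j. j - n0"])
        fix j assume "j \<in> {n0<..<?n}"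
        then have "n0 + (j - n0) = j" by simp
        with pos[of "j - n0"] show "of_nat ((j - n0 + r + 1) * k + (j - n0))
            = (of_nat (step_position n0 k j - step_position n0 k i) :: rat)" by (simp only:)
      qed (use Suc in auto)
      then show "label_factor n0 k ?n i = fact ((m + 2 + (n0 - Suc i)) * k + m) / fact k
            / (\<Prod>q=1..m. of_nat ((q + (n0 - Suc i) + 1) * k + q))"
        using i by (simp only: label_factor_def if_True top r_def [symmetric])
    qed simp
    also have "\<dots> = (\<Prod>r<n0. fact ((m + 2 + r) * k + m) / fact k
            / (\<Prod>q=1..m. of_nat ((q + r + 1) * k + q)))"
      by (rule prod.nat_diff_reindex)
    finally show ?thesis by (simp only: prod_dividef prod_constant card_lessThan)
  qed
  have heavy: "(\<Prod>j<n1. label_factor n0 k ?n (n0 + j))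
      = (\<Prod>q\<le>m. of_nat (q + 1) * (fact ((q + 1) * k + q) / fact k))"
  proof -
    have "(\<Prod>j<n1. label_factor n0 k ?n (n0 + j))
        = (\<Prod>j<n1. of_nat (n1 - Suc j + 1) * (fact ((n1 - Suc j + 1) * k + (n1 - Suc j)) / fact k))"
    proof (rule prod.cong)
      fix j assume "j \<in> {..<n1}"
      define q where "q = n1 - Suc j"
      have "?n - (n0 + j) = q + 1" using \<open>j \<in> {..<n1}\<close> by (simp add: q_def)
      moreover have "\<not> n0 + j < n0" by simp
      ultimately have "label_factor n0 k ?n (n0 + j) = fact ((q + 1) * (k + 1)) / fact (k + 1)"
        by (simp only: label_factor_def if_False)
      \<comment> \<open>the factors \<open>k + 1\<close> cancel, and \<open>q + 1\<close> remains: these make up the factor \<open>j + 1\<close> of the claim\<close>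
      also have "\<dots> = of_nat (q + 1) * of_nat (k + 1) * fact ((q + 1) * k + q)
          / (of_nat (k + 1) * fact k)"
      proof -
        have "(q + 1) * (k + 1) = Suc ((q + 1) * k + q)" by simp
        then have "(fact ((q + 1) * (k + 1)) :: rat)
            = of_nat ((q + 1) * (k + 1)) * fact ((q + 1) * k + q)" by (metis fact_Suc)
        moreover have "(fact (k + 1) :: rat) = of_nat (k + 1) * fact k"
          by (metis Suc_eq_plus1 fact_Suc)
        ultimately show ?thesis by (simp only: of_nat_mult)
      qed
      also have "\<dots> = of_nat (q + 1) * (fact ((q + 1) * k + q) / fact k)"
      proof -
        have "x * w * y / (w * z) = x * (y / z)" if "w \<noteq> 0" for w x y z :: rat
          using that by simp
        moreover have "of_nat (k + 1) \<noteq> (0 :: rat)" by (simp only: of_nat_eq_0_iff)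
        ultimately show ?thesis by blast
      qed
      finally show "label_factor n0 k ?n (n0 + j)
          = of_nat (n1 - Suc j + 1) * (fact ((n1 - Suc j + 1) * k + (n1 - Suc j)) / fact k)"
        by (simp only: q_def)
    qed simp
    also have "\<dots> = (\<Prod>q<n1. of_nat (q + 1) * (fact ((q + 1) * k + q) / fact k))"
      by (rule prod.nat_diff_reindex)
    finally show ?thesis by (simp only: Suc lessThan_Suc_atMost)
  qed
  let ?A = "\<Prod>r<n0. \<Prod>q=1..m. of_nat ((q + r + 1) * k + q) :: rat"
  let ?B = "\<Prod>r<n0. fact ((r + 1) * k) :: rat" and ?C = "\<Prod>q\<le>m. fact ((n0 + q + 1) * k + q) :: rat"
  let ?E = "\<Prod>q\<le>m. fact ((q + 1) * k + q) :: rat" and ?F = "\<Prod>r<n0. fact ((m + 2 + r) * k + m) :: rat"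
  have "of_nat ((\<Prod>r<n0. \<Prod>q=1..m. (q + r + 1) * k + q) * (\<Prod>r<n0. fact ((r + 1) * k))
      * (\<Prod>q\<le>m. fact ((n0 + q + 1) * k + q)))
    = (of_nat ((\<Prod>q\<le>m. fact ((q + 1) * k + q)) * (\<Prod>r<n0. fact ((m + 2 + r) * k + m))) :: rat)"
    by (simp only: staircase_fact_product)
  then have id: "?A * ?B * ?C = ?E * ?F"
    by (simp only: of_nat_mult of_nat_prod of_nat_fact)
  have A: "?A \<noteq> 0"
  proof -
    have "of_nat ((q + r + 1) * k + q) \<noteq> (0 :: rat)" if "q \<in> {1..m}" for q r
      using that by (simp only: of_nat_eq_0_iff) auto
    then show ?thesis by (simp add: prod_zero_iff del: of_nat_add of_nat_mult)
  qed
  have "(\<Prod>i<?n. label_factor n0 k ?n i)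
      = ?F / fact k ^ n0 / ?A * ((\<Prod>q\<le>m. of_nat (q + 1)) * (?E / fact k ^ Suc m))"
    unfolding prod_lessThan_add light heavy
    by (simp only: prod.distrib prod_dividef prod_constant card_atMost)
  also have "\<dots> = ?B / fact k ^ n0 * ((\<Prod>q\<le>m. of_nat (q + 1)) * (?C / fact k ^ Suc m))"
  proof -
    have "f / g / a * (w * (e / h)) = b / g * (w * (c / h))"
      if "a * b * c = e * f" "a \<noteq> 0" for a b c e f g h w :: rat
    proof -
      have "f / g / a * (w * (e / h)) = (e * f) / a * w / g / h" by (simp add: mult_ac)
      also have "\<dots> = b / g * (w * (c / h))" unfolding that(1) [symmetric] using that(2) by simp
      finally show ?thesis .
    qed
    from this[OF id A] show ?thesis .
  qed
  also have "\<dots> = (\<Prod>l<n0. fact (k * (l + 1)) / fact k)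
       * (\<Prod>j<n1. of_nat (j + 1) * fact (k * j + k + j + k * n0) / fact k)"
  proof -
    have "?C = (\<Prod>j\<le>m. fact (k * j + k + j + k * n0))"
      by (simp add: algebra_simps)
    then show ?thesis
      unfolding Suc lessThan_Suc_atMost
      by (simp only: prod.distrib prod_dividef prod_constant card_atMost card_lessThan mult.commute[of _ k]
          times_divide_eq_right)
  qed
  finally show ?thesis .
qed

lemma forrester_kernel:
  assumes "n = n0 + n1"
  shows "(\<Prod>(i, j)\<in>off_diag (n0 + 1) n. 1 - lratio i j) *
             (\<Prod>l = 1..n. (1 - lratio l 0) ^ a * (1 - lratio 0 l) ^ b) *
             (\<Prod>(i, j)\<in>off_diag 1 n. (1 - lratio i j) ^ k)
       = (\<Prod>(i, j)\<in>off_diag 0 n. (1 - lratio i j) ^ forrester_exponent n0 a b k i j)"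
proof -
  let ?f = "\<lambda>p. (1 - lratio (fst p) (snd p)) ^ forrester_exponent n0 a b k (fst p) (snd p)"
  have "(\<Prod>l=1..n. ?f (0, l) * ?f (l, 0)) = (\<Prod>l = 1..n. (1 - lratio l 0) ^ a * (1 - lratio 0 l) ^ b)"
    by (rule prod.cong) (auto simp: forrester_exponent_def mult.commute)
  moreover have "(\<Prod>p\<in>off_diag 1 n. ?f p) = (\<Prod>(i, j)\<in>off_diag (n0 + 1) n. 1 - lratio i j)
      * (\<Prod>(i, j)\<in>off_diag 1 n. (1 - lratio i j) ^ k)"
  proof -
    have "(\<Prod>p\<in>off_diag 1 n. ?f p) = (\<Prod>p\<in>off_diag 1 n.
        (if p \<in> off_diag (n0 + 1) n then 1 - lratio (fst p) (snd p) else 1)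
          * (1 - lratio (fst p) (snd p)) ^ k)"
      by (rule prod.cong) (auto simp: forrester_exponent_def min_gap_def off_diag_def)
    also have "\<dots> = (\<Prod>p\<in>off_diag 1 n \<inter> off_diag (n0 + 1) n. 1 - lratio (fst p) (snd p))
        * (\<Prod>p\<in>off_diag 1 n. (1 - lratio (fst p) (snd p)) ^ k)"
      by (simp add: prod.distrib prod.inter_restrict)
    also have "off_diag 1 n \<inter> off_diag (n0 + 1) n = off_diag (n0 + 1) n"
      by (auto simp: off_diag_def)
    finally show ?thesis by (simp add: case_prod_beta)
  qed
  ultimately show ?thesis
    unfolding case_prod_beta prod_off_diag_0 by (simp only: mult_ac)
qed

text \<open>
  Each position contributes \<open>(s + a + b)! / ((s + a)! (s + b)!)\<close> with \<open>s\<close> its place on the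
  staircase, \<open>k * l\<close> for the light position \<open>l\<close> and \<open>(k + 1) * j + k * n0\<close> for the heavy position
  \<open>n0 + j\<close>. The other factors are collected in \<open>prod_label_factors\<close>.
\<close>

theorem forrester_constant_term:
  fixes n0 n1 n a b k :: nat
  assumes "n = n0 + n1"
  shows "CT ((\<Prod>(i, j)\<in>off_diag (n0 + 1) n. 1 - lratio i j) *
             (\<Prod>l = 1..n. (1 - lratio l 0) ^ a * (1 - lratio 0 l) ^ b) *
             (\<Prod>(i, j)\<in>off_diag 1 n. (1 - lratio i j) ^ k))
       = M n0 a b k *
         (\<Prod>j<n1. (of_nat (j + 1) * fact ((k + 1) * j + a + b + k * n0)
                    * fact (k * j + k + j + k * n0)) /
                  (fact k * fact ((k + 1) * j + a + k * n0)
                    * fact ((k + 1) * j + b + k * n0)))"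
proof -
  let ?s = "step_position n0 k"
  let ?t = "\<lambda>i. fact (?s i + a + b) / (fact (?s i + a) * fact (?s i + b)) :: rat"
  have low: "?t l = fact (a + b + k * l) / (fact (a + k * l) * fact (b + k * l))" if "l < n0" for l
    using that by (simp add: step_position_def algebra_simps)
  have high: "?t (n0 + j) = fact ((k + 1) * j + a + b + k * n0)
      / (fact ((k + 1) * j + a + k * n0) * fact ((k + 1) * j + b + k * n0))" for j
    by (simp add: step_position_def algebra_simps)
  have "CT ((\<Prod>(i, j)\<in>off_diag (n0 + 1) n. 1 - lratio i j) *
             (\<Prod>l = 1..n. (1 - lratio l 0) ^ a * (1 - lratio 0 l) ^ b) *
             (\<Prod>(i, j)\<in>off_diag 1 n. (1 - lratio i j) ^ k))
      = (\<Prod>i<n. ?t i * label_factor n0 k n i)"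
    unfolding forrester_kernel[OF assms]
    using CT_eq_label_factors[of n0 n a b k] assms by simp
  also have "\<dots> = (\<Prod>l<n0. ?t l) * (\<Prod>j<n1. ?t (n0 + j)) * (\<Prod>i<n0 + n1. label_factor n0 k (n0 + n1) i)"
    unfolding assms prod.distrib prod_lessThan_add[of ?t] ..
  also have "(\<Prod>l<n0. ?t l) = (\<Prod>l<n0. fact (a + b + k * l) / (fact (a + k * l) * fact (b + k * l)))"
    by (rule prod.cong) (simp_all add: low)
  finally show ?thesis
    unfolding high prod_label_factors M_def
    by (simp add: prod.distrib prod_dividef mult_ac)
qed

theorem proposition5p5:
  fixes n0 n1 n a b k :: nat
  assumes "n = n0 + n1" and "1 \<le> n" and "n \<le> 5"
  shows "CT ((\<Prod>(i, j)\<in>off_diag (n0 + 1) n. 1 - lratio i j) *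
             (\<Prod>l = 1..n. (1 - lratio l 0) ^ a * (1 - lratio 0 l) ^ b) *
             (\<Prod>(i, j)\<in>off_diag 1 n. (1 - lratio i j) ^ k))
       = M n0 a b k *
         (\<Prod>j<n1. (of_nat (j + 1) * fact ((k + 1) * j + a + b + k * n0)
                    * fact (k * j + k + j + k * n0)) /
                  (fact k * fact ((k + 1) * j + a + k * n0)
                    * fact ((k + 1) * j + b + k * n0)))"
  using assms(1) by (rule forrester_constant_term)

end
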